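(* Let $G$ be a group, $M$ a $G$-module, and $0\to M\to T\xrightarrow{\partial}R\xrightarrow{p}G\to0$ a crossed extension of $G$ by $M$. Then the class in $H^3(G,M)$ corresponding to this crossed extension (equivalently, to the 2-group $\mathsf{Ca}_{T\to R}$) lies in the image of $\alpha^3:HS^3(G,M)\to H^3(G,M)$ if and only if there exists a symmetric $s$-functor $(F,\xi):\mathsf{Ca}_G\to\mathsf{Ca}_{T\to R}$ which is a section of the strict monoidal functor $p:\mathsf{Ca}_{T\to R}\to\mathsf{Ca}_G$.
   Context: **Symmetric cohomology.** Let $C^n(G,M)$ be the group of all functions $\phi:G^n\to M$, with coboundary $$d^n(\phi)(g_0,\dots,g_n)=g_0\phi(g_1,\dots,g_n)+\sum_{i=1}^n(-1)^i\phi(g_0,\dots,g_{i-2},g_{i-1}g_i,g_{i+1},\dots,g_n)+(-1)^{n+1}\phi(g_0,\dots,g_{n-1}).$$ Its cohomology is $H^*(G,M)$. The symmetric group $\Sigma_{n+1}$ acts on $C^n(G,M)$; the transpositions $\tau_i=(i,i+1)$, $1\le i\le n$, act (for $n\ge2$) by $(\tau_1\phi)(g_1,\dots,g_n)=-g_1\phi(g_1^{-1},g_1g_2,g_3,\dots,g_n)$; $(\tau_i\phi)(g_1,\dots,g_n)=-\phi(g_1,\dots,g_{i-2},g_{i-1}g_i,g_i^{-1},g_ig_{i+1},g_{i+2},\dots,g_n)$ for $1<i<n$; $(\tau_n\phi)(g_1,\dots,g_n)=-\phi(g_1,\dots,g_{n-2},g_{n-1}g_n,g_n^{-1})$ (for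 $n=1$, $(\tau_1\phi)(g)=-g\phi(g^{-1})$). $CS^n(G,M)=C^n(G,M)^{\Sigma_{n+1}}$ is a subcomplex; its cohomology is $HS^*(G,M)$, and $\alpha^n:HS^n(G,M)\to H^n(G,M)$ is induced by the inclusion. **Crossed extensions and their classes.** A crossed module is a group homomorphism $\partial:T\to R$ with an action $(r,t)\mapsto{}^rt$ of $R$ on $T$ by automorphisms such that $\partial({}^rt)=r\partial(t)r^{-1}$ and ${}^{\partial t}s=tst^{-1}$. A crossed extension of $G$ by $M$ is an exact sequence $0\to M\to T\xrightarrow{\partial}R\xrightarrow{p}G\to0$ where $\partial$ is a crossed module and the induced action of $G=\operatorname{Coker}\partial$ on $M=\operatorname{Ker}\partial$ is the given one. Choosing maps $s:G\to R$ and $\sigma:G\times G\to T$ with $ps(x)=x$ and $s(x)s(y)=\partial(\sigma(x,y))s(xy)$, the corresponding class in $H^3(G,M)$ is the class of the 3-cocycle $f(x,y,z)={}^{s(x)}\sigma(y,z)\,\sigma(x,yz)\,\sigma(xy,z)^{-1}\,\sigma(x,y)^{-1}$ (it is independent of choices). **2-groups.** A (strict) 2-group is a group object in the category of small categories; write $\cdot$ for its multiplication bifunctor. For a crossed module $\partial:T\to R$, the 2-group $\mathsf{Ca}_{T\to R}$ has as objects the elements of $R$; a morphism $r\to r'$ is an element $t\in T$ with $r'=\partial(t)r$, written $r\xrightarrow{t}r'$; the composite of $r\xrightarrow{t}r'\xrightarrow{t'}r''$ is $r\xrightarrow{t't}r''$. The multiplication on objects is that of $R$, and on morphisms $(r\xrightarrow{t}z)\cdot(x\xrightarrow{s}y)=\bigl(rx\xrightarrow{t({}^zs)}zy\bigr)$.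 $\mathsf{Ca}_G$ is $G$ regarded as a discrete category (the 2-group of the crossed module $1\to G$). The homomorphism $p:R\to G$ induces a strict monoidal functor $p:\mathsf{Ca}_{T\to R}\to\mathsf{Ca}_G$. **$s$-functors.** For 2-groups $\mathsf C,\mathsf D$, an $s$-functor $\mathsf C\to\mathsf D$ is a pair $(F,\xi)$ with $F:\mathsf C\to\mathsf D$ a functor and $\xi_{x,y}:F(x\cdot y)\to F(x)\cdot F(y)$ (also written $\xi(x,y)$) a family of morphisms natural in $x,y$. All $s$-functors are assumed normalised: $F(1)=1$ and $\xi_{x,y}=\mathrm{id}$ if $x=1$ or $y=1$. An $s$-functor $(F,\xi):\mathsf{Ca}_G\to\mathsf{Ca}_{T\to R}$ is a section of $p$ if $p\circ F=\mathrm{id}_{\mathsf{Ca}_G}$. An $s$-functor $(F,\xi)$ is symmetric if for all objects $x,y$ the following identities of morphisms hold: $$(\xi(x,y)\cdot\mathrm{id}_{F(y^{-1})})\circ\xi(xy,y^{-1})=\mathrm{id}_{F(x)}\cdot\xi(y,y^{-1}):\ F(x)\to F(x)\cdot F(y)\cdot F(y^{-1}),$$ $$(\mathrm{id}_{F(x)}\cdot\xi(x^{-1},y))\circ\xi(x,x^{-1}y)=\xi(x,x^{-1})\cdot\mathrm{id}_{F(y)}:\ F(y)\to F(x)\cdot F(x^{-1})\cdot F(y).$$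
   Formalization: The product of morphisms in Ca is taken as t(^r s), with r the source of the first factor, since the displayed t(^z s) is in general not a morphism rx → zy; the two agree when one factor is an identity, so the section and symmetry conditions are unaffected. *)

theory Defs
  imports "HOL-Algebra.Algebra"
begin

section \<open>Modules, crossed modules and crossed extensions\<close>

locale action_by_automorphisms = group_action G "carrier N" act + group N
  for G (structure) and N (structure) and act +
  assumes act_hom: "g \<in> carrier G \<Longrightarrow> act g \<in> hom N N"

text \<open>The abelian group underlying a module is written multiplicatively, as is customary for
  \<^locale>\<open>comm_group\<close>; sums and signs of the additive notation become products and
  powers with exponent \<open>\<plusminus>1\<close>.\<close>

locale group_module = action_by_automorphisms G M act + comm_group M
  for G (structure) and M (structure) and act

locale crossed_module = bd: group_hom T R bd + action_by_automorphisms R T act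
  for T (structure) and R (structure) and bd and act +
  assumes bd_act: "\<lbrakk>r \<in> carrier R; t \<in> carrier T\<rbrakk>
      \<Longrightarrow> bd (act r t) = r \<otimes>\<^bsub>R\<^esub> bd t \<otimes>\<^bsub>R\<^esub> inv\<^bsub>R\<^esub> r"
    and peiffer: "\<lbrakk>t \<in> carrier T; s \<in> carrier T\<rbrakk>
      \<Longrightarrow> act (bd t) s = t \<otimes>\<^bsub>T\<^esub> s \<otimes>\<^bsub>T\<^esub> inv\<^bsub>T\<^esub> t"

locale crossed_extension =
  group_module G M actM + crossed_module T R bd act + i: group_hom M T i + p: group_hom R G p
  for G (structure) and M (structure) and actM and T (structure) and R (structure)
    and i and bd and act and p +
  assumes exact_M: "inj_on i (carrier M)"
    and exact_T: "i ` carrier M = kernel T R bd"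
    and exact_R: "bd ` carrier T = kernel R G p"
    and exact_G: "p ` carrier R = carrier G"
    and induced_action: "\<lbrakk>r \<in> carrier R; m \<in> carrier M\<rbrakk> \<Longrightarrow> i (actM (p r) m) = act r (i m)"

section \<open>Group cohomology and symmetric cohomology\<close>

text \<open>A tuple \<open>(g\<^sub>1, \<dots>, g\<^sub>n)\<close> is a list of length \<open>n\<close>, so \<open>g\<^sub>k\<close> is the entry with index \<open>k - 1\<close>.\<close>

definition tuples :: "('g, 'x) monoid_scheme \<Rightarrow> nat \<Rightarrow> 'g list set" where
  "tuples G n = {gs. set gs \<subseteq> carrier G \<and> length gs = n}"

definition cochains ::
  "('g, 'x) monoid_scheme \<Rightarrow> ('m, 'y) monoid_scheme \<Rightarrow> nat \<Rightarrow> ('g list \<Rightarrow> 'm) monoid" where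
  "cochains G M n = product_group (tuples G n) (\<lambda>_. M)"

definition coboundary ::
  "('g, 'x) monoid_scheme \<Rightarrow> ('m, 'y) monoid_scheme \<Rightarrow> ('g \<Rightarrow> 'm \<Rightarrow> 'm) \<Rightarrow> nat
    \<Rightarrow> ('g list \<Rightarrow> 'm) \<Rightarrow> ('g list \<Rightarrow> 'm)" where
  "coboundary G M act n \<phi> = (\<lambda>gs \<in> tuples G (Suc n).
      act (hd gs) (\<phi> (tl gs))
      \<otimes>\<^bsub>M\<^esub> (\<Otimes>\<^bsub>M\<^esub>i\<in>{1..n}.
            \<phi> (take (i - 1) gs @ [gs ! (i - 1) \<otimes>\<^bsub>G\<^esub> gs ! i] @ drop (i + 1) gs)
              [^]\<^bsub>M\<^esub> ((- 1) ^ i :: int))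
      \<otimes>\<^bsub>M\<^esub> \<phi> (butlast gs) [^]\<^bsub>M\<^esub> ((- 1) ^ (n + 1) :: int))"

text \<open>The action of the transposition \<open>(i, i + 1) \<in> \<Sigma>\<^sub>n\<^sub>+\<^sub>1\<close> on \<open>n\<close>-cochains, for \<open>1 \<le> i \<le> n\<close>.\<close>

definition transp_act ::
  "('g, 'x) monoid_scheme \<Rightarrow> ('m, 'y) monoid_scheme \<Rightarrow> ('g \<Rightarrow> 'm \<Rightarrow> 'm) \<Rightarrow> nat \<Rightarrow> nat
    \<Rightarrow> ('g list \<Rightarrow> 'm) \<Rightarrow> ('g list \<Rightarrow> 'm)" where
  "transp_act G M act n i \<phi> = (\<lambda>gs \<in> tuples G n. inv\<^bsub>M\<^esub> (
      let g = (\<lambda>k. gs ! (k - 1)) in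
      if n = 1 then act (g 1) (\<phi> [inv\<^bsub>G\<^esub> (g 1)])
      else if i = 1 then act (g 1) (\<phi> ([inv\<^bsub>G\<^esub> (g 1), g 1 \<otimes>\<^bsub>G\<^esub> g 2] @ drop 2 gs))
      else if i < n then
        \<phi> (take (i - 2) gs
            @ [g (i - 1) \<otimes>\<^bsub>G\<^esub> g i, inv\<^bsub>G\<^esub> (g i), g i \<otimes>\<^bsub>G\<^esub> g (i + 1)]
            @ drop (i + 1) gs)
      else \<phi> (take (n - 2) gs @ [g (n - 1) \<otimes>\<^bsub>G\<^esub> g n, inv\<^bsub>G\<^esub> (g n)])))"

text \<open>The action of \<open>\<Sigma>\<^sub>n\<^sub>+\<^sub>1\<close> is given on the generators \<open>(i, i + 1)\<close>, so its invariants are the cochains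
  fixed by these; see \<open>sym_cochains_eq_invariants\<close> below.\<close>

definition sym_cochains ::
  "('g, 'x) monoid_scheme \<Rightarrow> ('m, 'y) monoid_scheme \<Rightarrow> ('g \<Rightarrow> 'm \<Rightarrow> 'm) \<Rightarrow> nat
    \<Rightarrow> ('g list \<Rightarrow> 'm) monoid" where
  "sym_cochains G M act n = (cochains G M n)
     \<lparr>carrier := {\<phi> \<in> carrier (cochains G M n). \<forall>i\<in>{1..n}. transp_act G M act n i \<phi> = \<phi>}\<rparr>"

lemma sym_cochains_eq_invariants:
  assumes act: "group_action (sym_group (Suc n)) (carrier (cochains G M n)) \<rho>"
    and transp: "\<And>i \<phi>. \<lbrakk>i \<in> {1..n}; \<phi> \<in> carrier (cochains G M n)\<rbrakk>
      \<Longrightarrow> \<rho> (transpose i (Suc i)) \<phi> = transp_act G M act n i \<phi>"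
  shows "carrier (sym_cochains G M act n) =
    {\<phi> \<in> carrier (cochains G M n). \<forall>\<pi>\<in>carrier (sym_group (Suc n)). \<rho> \<pi> \<phi> = \<phi>}"
proof -
  interpret group_action "sym_group (Suc n)" "carrier (cochains G M n)" \<rho>
    by (rule act)
  have mult: "\<rho> (\<pi> \<circ> \<pi>') \<phi> = \<rho> \<pi> (\<rho> \<pi>' \<phi>)"
    if "\<phi> \<in> carrier (cochains G M n)" "\<pi> permutes {1..Suc n}" "\<pi>' permutes {1..Suc n}" for \<pi> \<pi>' \<phi>
    using composition_rule[of \<phi> \<pi> \<pi>'] that by (simp add: sym_group_def)
  have swap: "transpose a b permutes {1..Suc n}" if "a \<in> {1..Suc n}" "b \<in> {1..Suc n}" for a b
    using that by (rule permutes_swap_id)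
  have fixed: "\<rho> \<pi> \<phi> = \<phi>"
    if \<phi>: "\<phi> \<in> carrier (cochains G M n)" and inv: "\<forall>i\<in>{1..n}. \<rho> (transpose i (Suc i)) \<phi> = \<phi>"
      and \<pi>: "\<pi> permutes {1..Suc n}" for \<pi> \<phi>
  proof -
    have rho_id: "\<rho> id \<phi> = \<phi>"
      using fun_cong[OF id_eq_one, of \<phi>] \<phi> by (simp add: sym_group_def)
    have tr: "a \<in> {1..Suc n} \<Longrightarrow> a + Suc k \<in> {1..Suc n} \<Longrightarrow> \<rho> (transpose a (a + Suc k)) \<phi> = \<phi>" for a k
    proof (induction k)
      case 0
      then show ?case using inv by simp
    next
      case (Suc k)
      let ?b = "a + Suc k"
      have b: "?b \<in> {1..n}" "?b \<in> {1..Suc n}" "Suc ?b \<in> {1..Suc n}"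
        using Suc.prems by auto
      have eq: "transpose a (Suc ?b) =
          transpose ?b (Suc ?b) \<circ> (transpose a ?b \<circ> transpose ?b (Suc ?b))"
        by (auto simp: fun_eq_iff transpose_def)
      have p: "transpose a ?b \<circ> transpose ?b (Suc ?b) permutes {1..Suc n}"
        using b Suc.prems by (intro permutes_compose swap) auto
      have "\<rho> (transpose a (Suc ?b)) \<phi> = \<phi>"
        unfolding eq using mult \<phi> p swap b Suc inv by auto
      then show ?case by simp
    qed
    have tr': "\<rho> (transpose a b) \<phi> = \<phi>" if "a \<in> {1..Suc n}" "b \<in> {1..Suc n}" for a b
    proof -
      consider "a = b" | "a < b" | "b < a" by linarith
      then show ?thesis
      proof cases
        case 1
        then show ?thesis using rho_id by simp
      next
        case 2
        then show ?thesis using tr[of a "b - Suc a"] that by auto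
      next
        case 3
        then show ?thesis using tr[of b "a - Suc b"] that by (auto simp: transpose_commute)
      qed
    qed
    have "finite {1..Suc n}" by simp
    with \<pi> show ?thesis
    proof (induction rule: permutes_induct)
      case id
      show ?case by (rule rho_id)
    next
      case (swap a b q)
      then show ?case
        using mult[OF \<phi> permutes_swap_id, of a b q] tr'[of a b] by metis
    qed
  qed
  have gens: "transpose i (Suc i) permutes {1..Suc n}" if "i \<in> {1..n}" for i
    using that by (intro swap) auto
  show ?thesis
    using fixed transp
    by (auto simp: sym_cochains_def sym_group_def) (metis gens transp atLeastAtMost_iff One_nat_def)
qed

text \<open>The cohomology in degree \<open>n\<close> of a sequence of groups \<open>C\<close> with differentials \<open>d n : C n \<rightarrow> C (n + 1)\<close>.\<close>

definition cocycles :: "(nat \<Rightarrow> 'c monoid) \<Rightarrow> (nat \<Rightarrow> 'c \<Rightarrow> 'c) \<Rightarrow> nat \<Rightarrow> 'c set" where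
  "cocycles C d n = kernel (C n) (C (Suc n)) (d n)"

definition coboundaries :: "(nat \<Rightarrow> 'c monoid) \<Rightarrow> (nat \<Rightarrow> 'c \<Rightarrow> 'c) \<Rightarrow> nat \<Rightarrow> 'c set" where
  "coboundaries C d n = (case n of 0 \<Rightarrow> {\<one>\<^bsub>C 0\<^esub>} | Suc k \<Rightarrow> d k ` carrier (C k))"

definition cohomology :: "(nat \<Rightarrow> 'c monoid) \<Rightarrow> (nat \<Rightarrow> 'c \<Rightarrow> 'c) \<Rightarrow> nat \<Rightarrow> 'c set monoid" where
  "cohomology C d n = (C n)\<lparr>carrier := cocycles C d n\<rparr> Mod coboundaries C d n"

definition group_cohomology ::
  "('g, 'x) monoid_scheme \<Rightarrow> ('m, 'y) monoid_scheme \<Rightarrow> ('g \<Rightarrow> 'm \<Rightarrow> 'm) \<Rightarrow> nat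
    \<Rightarrow> ('g list \<Rightarrow> 'm) set monoid" where
  "group_cohomology G M act = cohomology (cochains G M) (coboundary G M act)"

definition sym_cohomology ::
  "('g, 'x) monoid_scheme \<Rightarrow> ('m, 'y) monoid_scheme \<Rightarrow> ('g \<Rightarrow> 'm \<Rightarrow> 'm) \<Rightarrow> nat
    \<Rightarrow> ('g list \<Rightarrow> 'm) set monoid" where
  "sym_cohomology G M act = cohomology (sym_cochains G M act) (coboundary G M act)"

definition cohomology_class ::
  "('g, 'x) monoid_scheme \<Rightarrow> ('m, 'y) monoid_scheme \<Rightarrow> ('g \<Rightarrow> 'm \<Rightarrow> 'm) \<Rightarrow> nat
    \<Rightarrow> ('g list \<Rightarrow> 'm) \<Rightarrow> ('g list \<Rightarrow> 'm) set" where
  "cohomology_class G M act n \<phi> =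
     coboundaries (cochains G M) (coboundary G M act) n #>\<^bsub>cochains G M n\<^esub> \<phi>"

text \<open>The map induced by the inclusion of symmetric cochains: a class of \<open>sym_cohomology\<close> goes to the
  common class of its representatives.\<close>

definition alpha ::
  "('g, 'x) monoid_scheme \<Rightarrow> ('m, 'y) monoid_scheme \<Rightarrow> ('g \<Rightarrow> 'm \<Rightarrow> 'm) \<Rightarrow> nat
    \<Rightarrow> ('g list \<Rightarrow> 'm) set \<Rightarrow> ('g list \<Rightarrow> 'm) set" where
  "alpha G M act n c = the_elem (cohomology_class G M act n ` c)"

section \<open>The class of a crossed extension\<close>

definition lifting_pair ::
  "('g, 'x) monoid_scheme \<Rightarrow> ('t, 'y) monoid_scheme \<Rightarrow> ('r, 'z) monoid_scheme \<Rightarrow> ('t \<Rightarrow> 'r) \<Rightarrow> ('r \<Rightarrow> 'g)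
    \<Rightarrow> ('g \<Rightarrow> 'r) \<Rightarrow> ('g \<Rightarrow> 'g \<Rightarrow> 't) \<Rightarrow> bool" where
  "lifting_pair G T R bd p s \<sigma> \<longleftrightarrow>
     (\<forall>x\<in>carrier G. s x \<in> carrier R \<and> p (s x) = x) \<and>
     (\<forall>x\<in>carrier G. \<forall>y\<in>carrier G. \<sigma> x y \<in> carrier T \<and>
        s x \<otimes>\<^bsub>R\<^esub> s y = bd (\<sigma> x y) \<otimes>\<^bsub>R\<^esub> s (x \<otimes>\<^bsub>G\<^esub> y))"

text \<open>The values of the cocycle lie in the kernel of \<open>bd\<close>, which \<open>i\<close> identifies with \<open>M\<close>.\<close>

definition lifting_cocycle ::
  "('g, 'x) monoid_scheme \<Rightarrow> ('m, 'w) monoid_scheme \<Rightarrow> ('t, 'y) monoid_scheme \<Rightarrow> ('m \<Rightarrow> 't)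
    \<Rightarrow> ('r \<Rightarrow> 't \<Rightarrow> 't) \<Rightarrow> ('g \<Rightarrow> 'r) \<Rightarrow> ('g \<Rightarrow> 'g \<Rightarrow> 't) \<Rightarrow> 'g list \<Rightarrow> 'm" where
  "lifting_cocycle G M T i act s \<sigma> = (\<lambda>gs \<in> tuples G 3.
     let x = gs ! 0; y = gs ! 1; z = gs ! 2 in
     inv_into (carrier M) i
       (act (s x) (\<sigma> y z) \<otimes>\<^bsub>T\<^esub> \<sigma> x (y \<otimes>\<^bsub>G\<^esub> z)
         \<otimes>\<^bsub>T\<^esub> inv\<^bsub>T\<^esub> (\<sigma> (x \<otimes>\<^bsub>G\<^esub> y) z) \<otimes>\<^bsub>T\<^esub> inv\<^bsub>T\<^esub> (\<sigma> x y)))"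

definition crossed_extension_class ::
  "('g, 'x) monoid_scheme \<Rightarrow> ('m, 'w) monoid_scheme \<Rightarrow> ('g \<Rightarrow> 'm \<Rightarrow> 'm) \<Rightarrow> ('t, 'y) monoid_scheme
    \<Rightarrow> ('r, 'z) monoid_scheme \<Rightarrow> ('m \<Rightarrow> 't) \<Rightarrow> ('t \<Rightarrow> 'r) \<Rightarrow> ('r \<Rightarrow> 't \<Rightarrow> 't) \<Rightarrow> ('r \<Rightarrow> 'g)
    \<Rightarrow> ('g list \<Rightarrow> 'm) set" where
  "crossed_extension_class G M actM T R i bd act p =
     (THE c. \<exists>s \<sigma>. lifting_pair G T R bd p s \<sigma> \<and>
        c = cohomology_class G M actM 3 (lifting_cocycle G M T i act s \<sigma>))"

section \<open>2-groups and s-functors\<close>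

record ('o, 'a) two_group =
  objs :: "'o monoid"
  arrs :: "'a monoid"
  source :: "'a \<Rightarrow> 'o"
  target :: "'a \<Rightarrow> 'o"
  ident :: "'o \<Rightarrow> 'a"
  composite :: "'a \<Rightarrow> 'a \<Rightarrow> 'a"  (infixr "\<bullet>\<index>" 65)

text \<open>The composite \<open>b \<bullet> a\<close> is meaningful if \<open>source b = target a\<close>.

  A group object in small categories consists of a small category and group structures on its objects
  and on its arrows, such that multiplication is a functor (i.e. compatible with \<open>source\<close>, \<open>target\<close>,
  \<open>ident\<close> and \<open>composite\<close>). That the unit and the inverse are functors follows.\<close>

definition hom_set :: "('o, 'a, 'b) two_group_scheme \<Rightarrow> 'o \<Rightarrow> 'o \<Rightarrow> 'a set" where
  "hom_set C x y = {a \<in> carrier (arrs C). source C a = x \<and> target C a = y}"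

locale strict_two_group =
  O: group "objs C" + A: group "arrs C" for C (structure) +
  assumes ident_in_hom: "x \<in> carrier (objs C) \<Longrightarrow> ident C x \<in> hom_set C x x"
    and comp_in_hom: "\<lbrakk>a \<in> carrier (arrs C); b \<in> carrier (arrs C); source C b = target C a\<rbrakk>
      \<Longrightarrow> b \<bullet> a \<in> hom_set C (source C a) (target C b)"
    and comp_ident: "a \<in> carrier (arrs C) \<Longrightarrow> a \<bullet> ident C (source C a) = a"
    and ident_comp: "a \<in> carrier (arrs C) \<Longrightarrow> ident C (target C a) \<bullet> a = a"
    and comp_assoc: "\<lbrakk>a \<in> carrier (arrs C); b \<in> carrier (arrs C); c \<in> carrier (arrs C);
        source C b = target C a; source C c = target C b\<rbrakk> \<Longrightarrow> (c \<bullet> b) \<bullet> a = c \<bullet> (b \<bullet> a)"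
    and dom_hom: "source C \<in> hom (arrs C) (objs C)"
    and cod_hom: "target C \<in> hom (arrs C) (objs C)"
    and ident_hom: "ident C \<in> hom (objs C) (arrs C)"
    and interchange: "\<lbrakk>a \<in> carrier (arrs C); b \<in> carrier (arrs C); source C b = target C a;
        a' \<in> carrier (arrs C); b' \<in> carrier (arrs C); source C b' = target C a'\<rbrakk>
      \<Longrightarrow> (b \<otimes>\<^bsub>arrs C\<^esub> b') \<bullet> (a \<otimes>\<^bsub>arrs C\<^esub> a') = (b \<bullet> a) \<otimes>\<^bsub>arrs C\<^esub> (b' \<bullet> a')"

text \<open>The multiplication on arrows is \<open>(r, t) (x, s) = (r x, t (\<^sup>r s))\<close>, with the action of the
  \<^emph>\<open>source\<close> \<open>r\<close> of the first factor. Acting by its target \<open>z\<close> instead gives an element which is in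
  general not an arrow from \<open>r x\<close> to the product of the targets; the correct expression in terms of
  \<open>z\<close> is \<open>(\<^sup>z s) t\<close>.\<close>

definition Ca :: "('t, 'x) monoid_scheme \<Rightarrow> ('r, 'y) monoid_scheme \<Rightarrow> ('t \<Rightarrow> 'r) \<Rightarrow> ('r \<Rightarrow> 't \<Rightarrow> 't)
    \<Rightarrow> ('r, 'r \<times> 't) two_group" where
  "Ca T R bd act = \<lparr>
     objs = \<lparr>carrier = carrier R, monoid.mult = monoid.mult R, one = \<one>\<^bsub>R\<^esub>\<rparr>,
     arrs = \<lparr>carrier = carrier R \<times> carrier T,
             monoid.mult = (\<lambda>(r, t) (x, s). (r \<otimes>\<^bsub>R\<^esub> x, t \<otimes>\<^bsub>T\<^esub> act r s)),
             one = (\<one>\<^bsub>R\<^esub>, \<one>\<^bsub>T\<^esub>)\<rparr>,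
     source = fst,
     target = (\<lambda>(r, t). bd t \<otimes>\<^bsub>R\<^esub> r),
     ident = (\<lambda>r. (r, \<one>\<^bsub>T\<^esub>)),
     composite = (\<lambda>(r', t') (r, t). (r, t' \<otimes>\<^bsub>T\<^esub> t))\<rparr>"

definition Ca_discrete :: "('g, 'x) monoid_scheme \<Rightarrow> ('g, 'g \<times> unit) two_group" where
  "Ca_discrete G = Ca (singleton_group ()) G (\<lambda>_. \<one>\<^bsub>G\<^esub>) (\<lambda>_ t. t)"

lemma crossed_module_discrete:
  assumes "group G"
  shows "crossed_module (singleton_group ()) G (\<lambda>_. \<one>\<^bsub>G\<^esub>) (\<lambda>_ t. t)"
proof -
  interpret group G by (rule assms)
  interpret S: group "singleton_group ()" by simp
  have "(\<lambda>_ t. t) \<in> hom G (BijGroup (carrier (singleton_group ())))"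
    by (auto simp: hom_def BijGroup_def Bij_def bij_betw_def singleton_group_def compose_def
        fun_eq_iff)
  then have "group_hom G (BijGroup (carrier (singleton_group ()))) (\<lambda>_ t. t)"
    by (intro group_hom.intro group_hom_axioms.intro group_BijGroup is_group)
  then interpret group_action G "carrier (singleton_group ())" "\<lambda>_ t. t"
    by (rule group_action.intro)
  show ?thesis
    by unfold_locales (auto simp: hom_def singleton_group_def)
qed

lemma strict_two_group_Ca:
  assumes "crossed_module T R bd act"
  shows "strict_two_group (Ca T R bd act)"
proof -
  interpret crossed_module T R bd act by (rule assms)
  let ?C = "Ca T R bd act"
  have act_closed [simp]: "act r t \<in> carrier T" if "r \<in> carrier R" "t \<in> carrier T" for r t
    using element_image that by blast
  have act_mult: "act r (t \<otimes>\<^bsub>T\<^esub> s) = act r t \<otimes>\<^bsub>T\<^esub> act r s"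
    if "r \<in> carrier R" "t \<in> carrier T" "s \<in> carrier T" for r t s
    using act_hom that by (auto simp: hom_def)
  have act_act: "act (r \<otimes>\<^bsub>R\<^esub> r') t = act r (act r' t)"
    if "r \<in> carrier R" "r' \<in> carrier R" "t \<in> carrier T" for r r' t
    using composition_rule that by simp
  have act_one: "act \<one>\<^bsub>R\<^esub> t = t" if "t \<in> carrier T" for t
    using fun_cong[OF id_eq_one, of t] that by simp
  have act_unit: "act r \<one>\<^bsub>T\<^esub> = \<one>\<^bsub>T\<^esub>" if "r \<in> carrier R" for r
    using that by (metis act_closed act_mult bd.G.l_cancel_one' bd.G.one_closed bd.G.r_one)
  have arrs: "x \<in> carrier (arrs ?C) \<longleftrightarrow> (\<exists>r\<in>carrier R. \<exists>t\<in>carrier T. x = (r, t))" for x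
    by (auto simp: Ca_def)
  have O: "group (objs ?C)"
    by (rule groupI) (auto simp: Ca_def bd.H.m_assoc intro: bd.H.l_inv_ex)
  have A: "group (arrs ?C)"
  proof (rule groupI)
    fix x assume "x \<in> carrier (arrs ?C)"
    then obtain r t where x: "x = (r, t)" "r \<in> carrier R" "t \<in> carrier T"
      by (auto simp: arrs)
    let ?y = "(inv\<^bsub>R\<^esub> r, act (inv\<^bsub>R\<^esub> r) (inv\<^bsub>T\<^esub> t))"
    have "?y \<in> carrier (arrs ?C)" "?y \<otimes>\<^bsub>arrs ?C\<^esub> x = \<one>\<^bsub>arrs ?C\<^esub>"
      using x by (simp_all add: Ca_def act_unit flip: act_mult)
    then show "\<exists>y\<in>carrier (arrs ?C). y \<otimes>\<^bsub>arrs ?C\<^esub> x = \<one>\<^bsub>arrs ?C\<^esub>"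
      by blast
  qed (auto simp: Ca_def bd.G.m_assoc bd.H.m_assoc act_mult act_act act_one)
  have pf: "act (bd t \<otimes>\<^bsub>R\<^esub> r) s \<otimes>\<^bsub>T\<^esub> t = t \<otimes>\<^bsub>T\<^esub> act r s"
    if "t \<in> carrier T" "s \<in> carrier T" "r \<in> carrier R" for t s r
    using that by (simp add: act_act peiffer bd.G.m_assoc)
  have bd_mult: "bd (t \<otimes>\<^bsub>T\<^esub> act r s) \<otimes>\<^bsub>R\<^esub> (r \<otimes>\<^bsub>R\<^esub> x) = bd t \<otimes>\<^bsub>R\<^esub> r \<otimes>\<^bsub>R\<^esub> (bd s \<otimes>\<^bsub>R\<^esub> x)"
    if "t \<in> carrier T" "s \<in> carrier T" "r \<in> carrier R" "x \<in> carrier R" for t s r x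
  proof -
    have "inv\<^bsub>R\<^esub> r \<otimes>\<^bsub>R\<^esub> (r \<otimes>\<^bsub>R\<^esub> x) = x"
      using that by (simp flip: bd.H.m_assoc)
    then show ?thesis
      using that by (simp add: bd_act bd.H.m_assoc)
  qed
  have ic: "t' \<otimes>\<^bsub>T\<^esub> act (bd t \<otimes>\<^bsub>R\<^esub> r) s' \<otimes>\<^bsub>T\<^esub> (t \<otimes>\<^bsub>T\<^esub> act r s) =
      t' \<otimes>\<^bsub>T\<^esub> t \<otimes>\<^bsub>T\<^esub> act r (s' \<otimes>\<^bsub>T\<^esub> s)"
    if "t \<in> carrier T" "s \<in> carrier T" "t' \<in> carrier T" "s' \<in> carrier T" "r \<in> carrier R" for t s t' s' r
  proof -
    have "t' \<otimes>\<^bsub>T\<^esub> act (bd t \<otimes>\<^bsub>R\<^esub> r) s' \<otimes>\<^bsub>T\<^esub> (t \<otimes>\<^bsub>T\<^esub> act r s) =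
        t' \<otimes>\<^bsub>T\<^esub> (act (bd t \<otimes>\<^bsub>R\<^esub> r) s' \<otimes>\<^bsub>T\<^esub> t) \<otimes>\<^bsub>T\<^esub> act r s"
      using that by (simp add: bd.G.m_assoc)
    also have "\<dots> = t' \<otimes>\<^bsub>T\<^esub> t \<otimes>\<^bsub>T\<^esub> act r (s' \<otimes>\<^bsub>T\<^esub> s)"
      using that by (simp only: pf act_mult) (simp add: bd.G.m_assoc)
    finally show ?thesis .
  qed
  show ?thesis
  proof (rule strict_two_group.intro[OF O A], unfold_locales)
    show "ident ?C \<in> hom (objs ?C) (arrs ?C)"
      by (auto simp: hom_def Ca_def act_unit)
    show "source ?C \<in> hom (arrs ?C) (objs ?C)"
      by (auto simp: hom_def Ca_def)
    show "target ?C \<in> hom (arrs ?C) (objs ?C)"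
      by (auto simp: hom_def Ca_def bd_mult simp del: bd.hom_mult)
  next
    fix a b a' b'
    assume "a \<in> carrier (arrs ?C)" "b \<in> carrier (arrs ?C)" "source ?C b = target ?C a"
      "a' \<in> carrier (arrs ?C)" "b' \<in> carrier (arrs ?C)" "source ?C b' = target ?C a'"
    then show "b \<otimes>\<^bsub>arrs ?C\<^esub> b' \<bullet>\<^bsub>?C\<^esub> a \<otimes>\<^bsub>arrs ?C\<^esub> a' =
        (b \<bullet>\<^bsub>?C\<^esub> a) \<otimes>\<^bsub>arrs ?C\<^esub> (b' \<bullet>\<^bsub>?C\<^esub> a')"
      by (auto simp: Ca_def ic)
  qed (auto simp: Ca_def hom_set_def bd.G.m_assoc bd.H.m_assoc)
qed

lemma strict_two_group_Ca_discrete: "group G \<Longrightarrow> strict_two_group (Ca_discrete G)"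
  unfolding Ca_discrete_def by (intro strict_two_group_Ca crossed_module_discrete)

text \<open>A functor is given by its maps \<open>F\<close> on objects and \<open>F'\<close> on arrows.\<close>

locale two_group_functor = C: strict_two_group C + D: strict_two_group D
  for C (structure) and D (structure) and F and F' +
  assumes F_obj: "x \<in> carrier (objs C) \<Longrightarrow> F x \<in> carrier (objs D)"
    and F_arr: "a \<in> carrier (arrs C) \<Longrightarrow> F' a \<in> hom_set D (F (source C a)) (F (target C a))"
    and F_ident: "x \<in> carrier (objs C) \<Longrightarrow> F' (ident C x) = ident D (F x)"
    and F_comp: "\<lbrakk>a \<in> carrier (arrs C); b \<in> carrier (arrs C); source C b = target C a\<rbrakk>
      \<Longrightarrow> F' (b \<bullet>\<^bsub>C\<^esub> a) = F' b \<bullet>\<^bsub>D\<^esub> F' a"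

locale s_functor = two_group_functor C D F F'
  for C (structure) and D (structure) and F and F' and \<xi> +
  assumes \<xi>_in_hom: "\<lbrakk>x \<in> carrier (objs C); y \<in> carrier (objs C)\<rbrakk>
      \<Longrightarrow> \<xi> x y \<in> hom_set D (F (x \<otimes>\<^bsub>objs C\<^esub> y)) (F x \<otimes>\<^bsub>objs D\<^esub> F y)"
    and \<xi>_natural: "\<lbrakk>a \<in> carrier (arrs C); b \<in> carrier (arrs C)\<rbrakk>
      \<Longrightarrow> (F' a \<otimes>\<^bsub>arrs D\<^esub> F' b) \<bullet>\<^bsub>D\<^esub> \<xi> (source C a) (source C b)
        = \<xi> (target C a) (target C b) \<bullet>\<^bsub>D\<^esub> F' (a \<otimes>\<^bsub>arrs C\<^esub> b)"
    and F_one: "F \<one>\<^bsub>objs C\<^esub> = \<one>\<^bsub>objs D\<^esub>"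
    and \<xi>_one_left: "y \<in> carrier (objs C) \<Longrightarrow> \<xi> \<one>\<^bsub>objs C\<^esub> y = ident D (F y)"
    and \<xi>_one_right: "x \<in> carrier (objs C) \<Longrightarrow> \<xi> x \<one>\<^bsub>objs C\<^esub> = ident D (F x)"

locale symmetric_s_functor = s_functor C D F F' \<xi>
  for C (structure) and D (structure) and F and F' and \<xi> +
  assumes symmetric_right: "\<lbrakk>x \<in> carrier (objs C); y \<in> carrier (objs C)\<rbrakk>
      \<Longrightarrow> (\<xi> x y \<otimes>\<^bsub>arrs D\<^esub> ident D (F (inv\<^bsub>objs C\<^esub> y)))
            \<bullet>\<^bsub>D\<^esub> \<xi> (x \<otimes>\<^bsub>objs C\<^esub> y) (inv\<^bsub>objs C\<^esub> y)
        = ident D (F x) \<otimes>\<^bsub>arrs D\<^esub> \<xi> y (inv\<^bsub>objs C\<^esub> y)"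
    and symmetric_left: "\<lbrakk>x \<in> carrier (objs C); y \<in> carrier (objs C)\<rbrakk>
      \<Longrightarrow> (ident D (F x) \<otimes>\<^bsub>arrs D\<^esub> \<xi> (inv\<^bsub>objs C\<^esub> x) y)
            \<bullet>\<^bsub>D\<^esub> \<xi> x (inv\<^bsub>objs C\<^esub> x \<otimes>\<^bsub>objs C\<^esub> y)
        = \<xi> x (inv\<^bsub>objs C\<^esub> x) \<otimes>\<^bsub>arrs D\<^esub> ident D (F y)"

text \<open>The action of the functor \<open>Ca T R bd act \<rightarrow> Ca_discrete G\<close> induced by \<open>p : R \<rightarrow> G\<close> is \<open>p\<close> on objects
  and the following map on arrows.\<close>

definition Ca_proj_arr :: "('r \<Rightarrow> 'g) \<Rightarrow> 'r \<times> 't \<Rightarrow> 'g \<times> unit" where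
  "Ca_proj_arr p = (\<lambda>(r, t). (p r, ()))"

definition is_section :: "('o, 'a, 'b) two_group_scheme \<Rightarrow> ('u \<Rightarrow> 'o) \<Rightarrow> ('v \<Rightarrow> 'a)
    \<Rightarrow> ('o \<Rightarrow> 'u) \<Rightarrow> ('a \<Rightarrow> 'v) \<Rightarrow> bool" where
  "is_section C P P' F F' \<longleftrightarrow>
     (\<forall>x\<in>carrier (objs C). P (F x) = x) \<and> (\<forall>a\<in>carrier (arrs C). P' (F' a) = a)"

end

theory Submission
  imports Defs
begin

text \<open>
  A lifting of the crossed extension is a section \<open>s\<close> of \<open>p\<close> with elements \<open>\<sigma> x y\<close> of \<open>T\<close> such that
  \<open>s x s y = bd (\<sigma> x y) s (x y)\<close>; its cocycle \<open>f\<close> is the failure of associativity, i.e.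
  \<open>\<^sup>s\<^sup>x\<sigma>(y, z) \<sigma>(x, yz) = f(x, y, z) \<sigma>(x, y) \<sigma>(xy, z)\<close>. Two liftings have cohomologous cocycles, and
  every cocycle in their class is the cocycle of a lifting with the same \<open>s\<close>: multiplying \<open>\<sigma>\<close> by
  an \<open>M\<close>-valued \<open>\<beta>\<close> multiplies \<open>f\<close> by the coboundary of \<open>\<beta>\<close>. In what follows, \<open>M\<close> is written additively.

  A functor from the discrete category \<open>G\<close> that is a section of \<open>p\<close>, with its morphisms \<open>\<xi>\<close>, is the
  same as a lifting normalised by \<open>s 1 = 1\<close> and \<open>\<sigma>(1, x) = \<sigma>(x, 1) = 1\<close>. For a normalised lifting the two
  symmetry identities for \<open>\<xi>\<close> say precisely that \<open>f(x, y, y\<^sup>-\<^sup>1) = 0\<close> and \<open>f(x, x\<^sup>-\<^sup>1, y) = 0\<close>. In terms of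
  the homogeneous cochain \<open>\<phi>(a, b, c, d)\<close> with \<open>\<phi>(1, x, xy, xyz) = f(x, y, z)\<close>, normalisation and
  symmetry together thus make \<open>\<phi>\<close> vanish on all tuples with two equal entries at distance one or two.

  If \<open>\<phi>\<close> is a cocycle with this property, the cocycle identity on \<open>(a, b, a, c, d)\<close>, \<open>(a, b, c, b, d)\<close> and
  \<open>(a, b, c, d, c)\<close> says that \<open>\<phi>\<close> changes sign under the three transpositions, so \<open>f\<close> is symmetric
  (\<open>symmetric3_of_cocycle3\<close>).

  Conversely, a symmetric cocycle need not vanish on tuples with equal entries: its values there only have
  order at most two. The cocycle identity on \<open>(a, a, a, b, c)\<close> gives \<open>\<phi>(a, a, b, c) = k(a, b) + k(a, c)\<close>
  with \<open>k(a, b) = \<phi>(a, a, a, b)\<close>. Hence the symmetric 2-cochain which takes the value \<open>k(a, b)\<close> on every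
  arrangement of \<open>a, a, b\<close>, and is zero on tuples with distinct entries, has a coboundary that agrees with \<open>\<phi>\<close>
  on \<open>(a, a, a, b)\<close>, \<open>(a, b, b, b)\<close>, \<open>(a, b, a, c)\<close> and \<open>(a, b, c, b)\<close>
  (\<open>cobd2_degenerate_cobounding\<close>). The difference is the cocycle of a lifting with \<open>s 1 = 1\<close>. Its values
  being zero at these tuples, \<open>\<sigma>\<close> becomes normalised, without changing the cocycle, after
  division by the coboundary \<open>(x, y) \<mapsto> x m\<close> of a constant, and then satisfies the symmetry identities
  (\<open>symmetric_lifting_of_defect\<close>).
\<close>

section \<open>Symmetric cocycles in degree three\<close>

sublocale group_module \<subseteq> base: group G
  using group_hom by (rule group_hom.axioms(1))

context group_module
begin

lemma act_closed [simp]: "g \<in> carrier G \<Longrightarrow> m \<in> carrier M \<Longrightarrow> act g m \<in> carrier M"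
  using element_image by blast

lemma act_mult:
  "g \<in> carrier G \<Longrightarrow> m \<in> carrier M \<Longrightarrow> n \<in> carrier M
    \<Longrightarrow> act g (m \<otimes>\<^bsub>M\<^esub> n) = act g m \<otimes>\<^bsub>M\<^esub> act g n"
  using act_hom by (auto simp: hom_def)

lemma act_act:
  "g \<in> carrier G \<Longrightarrow> h \<in> carrier G \<Longrightarrow> m \<in> carrier M \<Longrightarrow> act g (act h m) = act (g \<otimes> h) m"
  using composition_rule by simp

lemma act_one [simp]: "m \<in> carrier M \<Longrightarrow> act \<one> m = m"
  using fun_cong[OF id_eq_one, of m] by simp

lemma act_unit [simp]: "g \<in> carrier G \<Longrightarrow> act g \<one>\<^bsub>M\<^esub> = \<one>\<^bsub>M\<^esub>"
  by (metis act_closed act_mult l_cancel_one' one_closed r_one)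

lemma act_inv: "g \<in> carrier G \<Longrightarrow> m \<in> carrier M \<Longrightarrow> act g (inv\<^bsub>M\<^esub> m) = inv\<^bsub>M\<^esub> (act g m)"
  by (metis act_closed act_mult act_unit inv_closed inv_equality l_inv)

lemma base_inv_mult_cancel [simp]:
  "x \<in> carrier G \<Longrightarrow> y \<in> carrier G \<Longrightarrow> inv x \<otimes> (x \<otimes> y) = y"
  "x \<in> carrier G \<Longrightarrow> y \<in> carrier G \<Longrightarrow> x \<otimes> (inv x \<otimes> y) = y"
  by (simp_all flip: base.m_assoc)

text \<open>The coboundary of an inhomogeneous 2-cochain. Cochains in low degree are functions of several
  arguments here; only their values on \<open>carrier G\<close> matter.\<close>

definition cobd2 :: "('a \<Rightarrow> 'a \<Rightarrow> 'c) \<Rightarrow> 'a \<Rightarrow> 'a \<Rightarrow> 'a \<Rightarrow> 'c" where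
  "cobd2 \<beta> x y z = act x (\<beta> y z) \<otimes>\<^bsub>M\<^esub> \<beta> x (y \<otimes> z) \<otimes>\<^bsub>M\<^esub> inv\<^bsub>M\<^esub> (\<beta> x y \<otimes>\<^bsub>M\<^esub> \<beta> (x \<otimes> y) z)"

text \<open>The 3-cocycle identity, with the negative terms moved to the right-hand side.\<close>

definition cocycle3 :: "('a \<Rightarrow> 'a \<Rightarrow> 'a \<Rightarrow> 'c) \<Rightarrow> bool" where
  "cocycle3 f \<longleftrightarrow>
     (\<forall>a\<in>carrier G. \<forall>b\<in>carrier G. \<forall>c\<in>carrier G. f a b c \<in> carrier M) \<and>
     (\<forall>a\<in>carrier G. \<forall>b\<in>carrier G. \<forall>c\<in>carrier G. \<forall>d\<in>carrier G.
        act a (f b c d) \<otimes>\<^bsub>M\<^esub> f a (b \<otimes> c) d \<otimes>\<^bsub>M\<^esub> f a b c = f a b (c \<otimes> d) \<otimes>\<^bsub>M\<^esub> f (a \<otimes> b) c d)"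

text \<open>Invariance under the transpositions that generate the symmetric group on four letters.\<close>

definition symmetric3 :: "('a \<Rightarrow> 'a \<Rightarrow> 'a \<Rightarrow> 'c) \<Rightarrow> bool" where
  "symmetric3 f \<longleftrightarrow>
     (\<forall>x\<in>carrier G. \<forall>y\<in>carrier G. \<forall>z\<in>carrier G.
        f x y z = inv\<^bsub>M\<^esub> (act x (f (inv x) (x \<otimes> y) z)) \<and>
        f x y z = inv\<^bsub>M\<^esub> (f (x \<otimes> y) (inv y) (y \<otimes> z)) \<and>
        f x y z = inv\<^bsub>M\<^esub> (f x (y \<otimes> z) (inv z)))"

text \<open>Vanishing whenever an argument is trivial.\<close>

definition normalised3 :: "('a \<Rightarrow> 'a \<Rightarrow> 'a \<Rightarrow> 'c) \<Rightarrow> bool" where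
  "normalised3 f \<longleftrightarrow>
     (\<forall>x\<in>carrier G. \<forall>y\<in>carrier G.
        f \<one> x y = \<one>\<^bsub>M\<^esub> \<and> f x \<one> y = \<one>\<^bsub>M\<^esub> \<and> f x y \<one> = \<one>\<^bsub>M\<^esub>)"

lemma cocycle3_cong:
  assumes "\<And>x y z. x \<in> carrier G \<Longrightarrow> y \<in> carrier G \<Longrightarrow> z \<in> carrier G \<Longrightarrow> f x y z = f' x y z"
  shows "cocycle3 f \<longleftrightarrow> cocycle3 f'"
  unfolding cocycle3_def by (simp add: assms)

lemma symmetric3_cong:
  assumes "\<And>x y z. x \<in> carrier G \<Longrightarrow> y \<in> carrier G \<Longrightarrow> z \<in> carrier G \<Longrightarrow> f x y z = f' x y z"
  shows "symmetric3 f \<longleftrightarrow> symmetric3 f'"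
  unfolding symmetric3_def by (simp add: assms)

lemma cobd2_closed:
  assumes "\<And>x y. x \<in> carrier G \<Longrightarrow> y \<in> carrier G \<Longrightarrow> \<beta> x y \<in> carrier M"
    and "x \<in> carrier G" "y \<in> carrier G" "z \<in> carrier G"
  shows "cobd2 \<beta> x y z \<in> carrier M"
  using assms by (simp add: cobd2_def)

lemma cobd2_mult:
  assumes "\<And>x y. x \<in> carrier G \<Longrightarrow> y \<in> carrier G \<Longrightarrow> \<beta> x y \<in> carrier M"
    and "\<And>x y. x \<in> carrier G \<Longrightarrow> y \<in> carrier G \<Longrightarrow> \<gamma> x y \<in> carrier M"
    and "x \<in> carrier G" "y \<in> carrier G" "z \<in> carrier G"
  shows "cobd2 (\<lambda>x y. \<beta> x y \<otimes>\<^bsub>M\<^esub> \<gamma> x y) x y z = cobd2 \<beta> x y z \<otimes>\<^bsub>M\<^esub> cobd2 \<gamma> x y z"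
  using assms by (simp add: cobd2_def act_mult inv_mult m_ac)

lemma cobd2_inv:
  assumes "\<And>x y. x \<in> carrier G \<Longrightarrow> y \<in> carrier G \<Longrightarrow> \<beta> x y \<in> carrier M"
    and "x \<in> carrier G" "y \<in> carrier G" "z \<in> carrier G"
  shows "cobd2 (\<lambda>x y. inv\<^bsub>M\<^esub> (\<beta> x y)) x y z = inv\<^bsub>M\<^esub> (cobd2 \<beta> x y z)"
  using assms by (simp add: cobd2_def act_inv inv_mult m_ac)

text \<open>Each transposition identity is the cocycle identity at a quadruple of which all but two terms vanish.\<close>

lemma symmetric3_of_cocycle3:
  assumes f: "cocycle3 f" and norm: "normalised3 f"
    and left: "\<And>x y. x \<in> carrier G \<Longrightarrow> y \<in> carrier G \<Longrightarrow> f x (inv x) y = \<one>\<^bsub>M\<^esub>"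
    and right: "\<And>x y. x \<in> carrier G \<Longrightarrow> y \<in> carrier G \<Longrightarrow> f x y (inv y) = \<one>\<^bsub>M\<^esub>"
  shows "symmetric3 f"
  unfolding symmetric3_def
proof (intro ballI conjI)
  fix x y z assume G [simp]: "x \<in> carrier G" "y \<in> carrier G" "z \<in> carrier G"
  have [simp]: "f a b c \<in> carrier M"
    if "a \<in> carrier G" "b \<in> carrier G" "c \<in> carrier G" for a b c
    using f that by (simp add: cocycle3_def)
  have [simp]: "f \<one> a b = \<one>\<^bsub>M\<^esub>" "f a \<one> b = \<one>\<^bsub>M\<^esub>" "f a b \<one> = \<one>\<^bsub>M\<^esub>"
    if "a \<in> carrier G" "b \<in> carrier G" for a b
    using norm that by (simp_all add: normalised3_def)
  have coc: "act a (f b c d) \<otimes>\<^bsub>M\<^esub> f a (b \<otimes> c) d \<otimes>\<^bsub>M\<^esub> f a b c = f a b (c \<otimes> d) \<otimes>\<^bsub>M\<^esub> f (a \<otimes> b) c d"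
    if "a \<in> carrier G" "b \<in> carrier G" "c \<in> carrier G" "d \<in> carrier G" for a b c d
    using f that by (simp add: cocycle3_def)
  have eq_inv: "m = inv\<^bsub>M\<^esub> n" if "m \<otimes>\<^bsub>M\<^esub> n = \<one>\<^bsub>M\<^esub>" "m \<in> carrier M" "n \<in> carrier M" for m n
    using that by (metis inv_equality)
  show "f x y z = inv\<^bsub>M\<^esub> (act x (f (inv x) (x \<otimes> y) z))"
    using coc[of x "inv x" "x \<otimes> y" z] by (intro eq_inv) (simp_all add: left m_comm)
  show "f x y z = inv\<^bsub>M\<^esub> (f (x \<otimes> y) (inv y) (y \<otimes> z))"
    using coc[of x y "inv y" "y \<otimes> z"] by (intro eq_inv) (simp_all add: left right)
  show "f x y z = inv\<^bsub>M\<^esub> (f x (y \<otimes> z) (inv z))"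
    using coc[of x y z "inv z"] by (intro eq_inv) (simp_all add: right m_comm)
qed

text \<open>The 2-cochain that matches a symmetric 3-cocycle \<open>f\<close> on degenerate arguments. With
  \<open>k y = f \<one> \<one> y\<close>, homogeneously \<open>k(a, b) = a k(a\<^sup>-\<^sup>1 b)\<close>, it is the cochain that takes the
  value \<open>k(a, b)\<close> on the three arrangements of \<open>a, a, b\<close>: the first three cases are the triples
  \<open>(1, x, xy)\<close> with equality of the first two entries, of the last two, and of the outer two. Where
  several cases apply the values agree.\<close>

definition degenerate_cobounding :: "('a \<Rightarrow> 'a \<Rightarrow> 'a \<Rightarrow> 'c) \<Rightarrow> 'a \<Rightarrow> 'a \<Rightarrow> 'c" where
  "degenerate_cobounding f x y =
     (if x = \<one> then f \<one> \<one> y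
      else if y = \<one> then act x (f \<one> \<one> (inv x))
      else if x \<otimes> y = \<one> then f \<one> \<one> x
      else \<one>\<^bsub>M\<^esub>)"

text \<open>The values of a symmetric 3-cocycle at degenerate arguments are determined by \<open>f \<one> \<one>\<close>. The first
  transposition fixes the arguments \<open>(1, y, z)\<close>, so \<open>f\<close> takes values of order at most two there; this
  is why signs play no role below.\<close>

lemma degenerate_values:
  assumes f: "cocycle3 f" and sym: "symmetric3 f" and G [simp]: "x \<in> carrier G" "y \<in> carrier G"
  shows "f \<one> \<one> y \<otimes>\<^bsub>M\<^esub> f \<one> \<one> y = \<one>\<^bsub>M\<^esub>"
    and "f \<one> \<one> \<one> = \<one>\<^bsub>M\<^esub>"
    and "f x \<one> \<one> = act x (f \<one> \<one> (inv x))"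
    and "f x (inv x) y = f \<one> \<one> x \<otimes>\<^bsub>M\<^esub> f \<one> \<one> y"
    and "f x y (inv y) = act x (f \<one> \<one> (inv x)) \<otimes>\<^bsub>M\<^esub> act x (f \<one> \<one> y)"
proof -
  have f_closed [simp]: "f a b c \<in> carrier M"
    if "a \<in> carrier G" "b \<in> carrier G" "c \<in> carrier G" for a b c
    using f that by (simp add: cocycle3_def)
  have coc: "act a (f b c d) \<otimes>\<^bsub>M\<^esub> f a (b \<otimes> c) d \<otimes>\<^bsub>M\<^esub> f a b c = f a b (c \<otimes> d) \<otimes>\<^bsub>M\<^esub> f (a \<otimes> b) c d"
    if "a \<in> carrier G" "b \<in> carrier G" "c \<in> carrier G" "d \<in> carrier G" for a b c d
    using f that by (simp add: cocycle3_def)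
  have s: "f a b c = inv\<^bsub>M\<^esub> (act a (f (inv a) (a \<otimes> b) c))"
      "f a b c = inv\<^bsub>M\<^esub> (f (a \<otimes> b) (inv b) (b \<otimes> c))"
      "f a b c = inv\<^bsub>M\<^esub> (f a (b \<otimes> c) (inv c))"
    if "a \<in> carrier G" "b \<in> carrier G" "c \<in> carrier G" for a b c
    using sym that unfolding symmetric3_def by blast+
  have inv_self: "inv\<^bsub>M\<^esub> (f \<one> a b) = f \<one> a b" if "a \<in> carrier G" "b \<in> carrier G" for a b
    using s(1)[of \<one> a b] that by simp
  have two: "f \<one> a b \<otimes>\<^bsub>M\<^esub> f \<one> a b = \<one>\<^bsub>M\<^esub>" if "a \<in> carrier G" "b \<in> carrier G" for a b
    using that by (metis base.one_closed inv_self l_inv f_closed)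
  show "f \<one> \<one> y \<otimes>\<^bsub>M\<^esub> f \<one> \<one> y = \<one>\<^bsub>M\<^esub>"
    by (simp add: two)
  have k: "f \<one> a b = f \<one> \<one> (a \<otimes> b) \<otimes>\<^bsub>M\<^esub> f \<one> \<one> a" if [simp]: "a \<in> carrier G" "b \<in> carrier G" for a b
  proof -
    have "f \<one> \<one> a = f \<one> a b \<otimes>\<^bsub>M\<^esub> f \<one> \<one> (a \<otimes> b)"
      using coc[of \<one> \<one> a b] by (simp add: two m_comm)
    then have "f \<one> \<one> (a \<otimes> b) \<otimes>\<^bsub>M\<^esub> f \<one> \<one> a = f \<one> \<one> (a \<otimes> b) \<otimes>\<^bsub>M\<^esub> f \<one> \<one> (a \<otimes> b) \<otimes>\<^bsub>M\<^esub> f \<one> a b"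
      by (simp add: m_ac)
    then show ?thesis
      by (simp add: two)
  qed
  show k1: "f \<one> \<one> \<one> = \<one>\<^bsub>M\<^esub>"
    using k[of \<one> \<one>] by (simp add: two)
  have mid: "f a \<one> b = act a (f \<one> \<one> (inv a)) \<otimes>\<^bsub>M\<^esub> act a (f \<one> \<one> b)"
    if [simp]: "a \<in> carrier G" "b \<in> carrier G" for a b
  proof -
    have "f a \<one> b = inv\<^bsub>M\<^esub> (act a (f (inv a) a b))"
      using s(1)[of a \<one> b] by simp
    also have "f (inv a) a b = inv\<^bsub>M\<^esub> (f \<one> (inv a) (a \<otimes> b))"
      using s(2)[of "inv a" a b] by simp
    also have "f \<one> (inv a) (a \<otimes> b) = f \<one> \<one> b \<otimes>\<^bsub>M\<^esub> f \<one> \<one> (inv a)"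
      by (subst k) simp_all
    finally show ?thesis
      by (simp add: act_inv act_mult m_comm)
  qed
  show "f x \<one> \<one> = act x (f \<one> \<one> (inv x))"
    by (simp add: mid[of x \<one>] k1)
  have "f x (inv x) y = inv\<^bsub>M\<^esub> (f \<one> x (inv x \<otimes> y))"
    using s(2)[of x "inv x" y] by simp
  also have "\<dots> = f \<one> x (inv x \<otimes> y)"
    by (simp add: inv_self)
  also have "\<dots> = f \<one> \<one> x \<otimes>\<^bsub>M\<^esub> f \<one> \<one> y"
    by (subst k) (simp_all add: m_comm)
  finally show "f x (inv x) y = f \<one> \<one> x \<otimes>\<^bsub>M\<^esub> f \<one> \<one> y" .
  have "f x y (inv y) = inv\<^bsub>M\<^esub> (f x \<one> y)"
    using s(3)[of x y "inv y"] by simp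
  also have "\<dots> = act x (inv\<^bsub>M\<^esub> (f \<one> \<one> (inv x))) \<otimes>\<^bsub>M\<^esub> act x (inv\<^bsub>M\<^esub> (f \<one> \<one> y))"
    by (simp add: mid[of x y] inv_mult act_inv)
  finally show "f x y (inv y) = act x (f \<one> \<one> (inv x)) \<otimes>\<^bsub>M\<^esub> act x (f \<one> \<one> y)"
    by (simp add: inv_self)
qed

text \<open>Since the values concerned have order at most two, equality of the coboundary with \<open>f\<close> is stated as
  triviality of their product.\<close>

lemma cobd2_degenerate_cobounding:
  assumes f: "cocycle3 f" and sym: "symmetric3 f" and G [simp]: "x \<in> carrier G" "y \<in> carrier G"
  shows "cobd2 (degenerate_cobounding f) \<one> \<one> y \<otimes>\<^bsub>M\<^esub> f \<one> \<one> y = \<one>\<^bsub>M\<^esub>"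
    and "cobd2 (degenerate_cobounding f) x \<one> \<one> \<otimes>\<^bsub>M\<^esub> f x \<one> \<one> = \<one>\<^bsub>M\<^esub>"
    and "cobd2 (degenerate_cobounding f) x (inv x) y \<otimes>\<^bsub>M\<^esub> f x (inv x) y = \<one>\<^bsub>M\<^esub>"
    and "cobd2 (degenerate_cobounding f) x y (inv y) \<otimes>\<^bsub>M\<^esub> f x y (inv y) = \<one>\<^bsub>M\<^esub>"
proof -
  let ?k = "f \<one> \<one>" and ?p = "degenerate_cobounding f"
  have f_closed [simp]: "f a b c \<in> carrier M"
    if "a \<in> carrier G" "b \<in> carrier G" "c \<in> carrier G" for a b c
    using f that by (simp add: cocycle3_def)
  note val = degenerate_values[OF f sym]
  have two: "?k a \<otimes>\<^bsub>M\<^esub> ?k a = \<one>\<^bsub>M\<^esub>" if "a \<in> carrier G" for a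
    using val(1)[of a a] that by simp
  have k1 [simp]: "?k \<one> = \<one>\<^bsub>M\<^esub>"
    by (rule val(2)[of \<one> \<one>]) simp_all
  have self [simp]: "inv\<^bsub>M\<^esub> (?k a) = ?k a" if "a \<in> carrier G" for a
    using two[of a] that by (metis base.one_closed inv_equality f_closed)
  have self_act [simp]: "inv\<^bsub>M\<^esub> (act a (?k b)) = act a (?k b)" if "a \<in> carrier G" "b \<in> carrier G" for a b
    using that by (simp flip: act_inv)
  have p_closed [simp]: "?p a b \<in> carrier M" if "a \<in> carrier G" "b \<in> carrier G" for a b
    using that by (simp add: degenerate_cobounding_def)
  have p_left [simp]: "?p \<one> a = ?k a" if "a \<in> carrier G" for a
    by (simp add: degenerate_cobounding_def)
  have p_right [simp]: "?p a \<one> = act a (?k (inv a))" if "a \<in> carrier G" for a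
    using that by (simp add: degenerate_cobounding_def)
  have p_inv [simp]: "?p a (inv a) = ?k a" "?p (inv a) a = ?k (inv a)" if "a \<in> carrier G" for a
    using that by (auto simp: degenerate_cobounding_def)
  have p_self: "inv\<^bsub>M\<^esub> (?p a b) = ?p a b" if "a \<in> carrier G" "b \<in> carrier G" for a b
    using that by (simp add: degenerate_cobounding_def)
  \<comment> \<open>Homogeneously, the cochain is invariant under permutation of its three arguments; these are the
    invariances under the two adjacent transpositions.\<close>
  have p_swap_right: "?p (x \<otimes> y) (inv y) = ?p x y"
  proof (cases "x = \<one> \<or> y = \<one> \<or> x \<otimes> y = \<one>")
    case True
    then show ?thesis
    proof (elim disjE)
      assume "x \<otimes> y = \<one>"
      then have "y = inv x"
        by (metis G base.inv_equality base.inv_inv)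
      then show ?thesis
        by simp
    qed simp_all
  next
    case False
    moreover from False have "inv y \<noteq> \<one>" "x \<otimes> y \<otimes> inv y \<noteq> \<one>"
      by (auto simp: base.m_assoc base.inv_eq_1_iff)
    ultimately show ?thesis
      by (simp add: degenerate_cobounding_def)
  qed
  have p_swap_left: "act x (?p (inv x) y) = ?p x (inv x \<otimes> y)"
  proof (cases "x = \<one> \<or> y = \<one> \<or> x = y")
    case True
    then show ?thesis
      by (auto simp: act_act)
  next
    case False
    moreover from False have "inv x \<noteq> \<one>" "inv x \<otimes> y \<noteq> \<one>"
      by (auto simp: base.inv_eq_1_iff) (metis G base.inv_equality base.inv_inv base.inv_closed)
    ultimately show ?thesis
      by (simp add: degenerate_cobounding_def)
  qed
  show "cobd2 ?p \<one> \<one> y \<otimes>\<^bsub>M\<^esub> f \<one> \<one> y = \<one>\<^bsub>M\<^esub>"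
    by (simp add: cobd2_def two m_assoc)
  have "act x (?k a) \<otimes>\<^bsub>M\<^esub> act x (?k a) = \<one>\<^bsub>M\<^esub>" if "a \<in> carrier G" for a
    using that by (simp add: two flip: act_mult)
  note this[simp]
  show "cobd2 ?p x \<one> \<one> \<otimes>\<^bsub>M\<^esub> f x \<one> \<one> = \<one>\<^bsub>M\<^esub>"
    by (simp add: cobd2_def inv_mult val(3)[of x x])
  have "cobd2 ?p x (inv x) y = ?k x \<otimes>\<^bsub>M\<^esub> ?k y"
    using p_self[of x "inv x \<otimes> y"]
    by (simp add: cobd2_def p_swap_left inv_mult) (metis (no_types, lifting) p_closed G base.inv_closed base.m_closed l_inv l_one)
  then show "cobd2 ?p x (inv x) y \<otimes>\<^bsub>M\<^esub> f x (inv x) y = \<one>\<^bsub>M\<^esub>"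
    by (simp add: val(4)) (simp add: m_ac two)
  have "inv\<^bsub>M\<^esub> (?p x y \<otimes>\<^bsub>M\<^esub> ?p x y) = \<one>\<^bsub>M\<^esub>"
    using p_self[of x y] by (metis p_closed G inv_one l_inv)
  then have "cobd2 ?p x y (inv y) = act x (?k (inv x)) \<otimes>\<^bsub>M\<^esub> act x (?k y)"
    by (simp add: cobd2_def p_swap_right m_comm)
  then show "cobd2 ?p x y (inv y) \<otimes>\<^bsub>M\<^esub> f x y (inv y) = \<one>\<^bsub>M\<^esub>"
    by (simp add: val(5)) (simp add: m_assoc m_lcomm[of "act x (?k y)"])
qed

end

section \<open>Liftings of a crossed extension and their cocycles\<close>

context crossed_extension
begin

lemma crossed_act_closed [simp]: "r \<in> carrier R \<Longrightarrow> t \<in> carrier T \<Longrightarrow> act r t \<in> carrier T"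
  using crossed_module.axioms(2)[OF crossed_module_axioms]
  by (meson action_by_automorphisms.axioms(1) group_action.element_image)

lemma crossed_act_mult:
  "r \<in> carrier R \<Longrightarrow> t \<in> carrier T \<Longrightarrow> u \<in> carrier T
    \<Longrightarrow> act r (t \<otimes>\<^bsub>T\<^esub> u) = act r t \<otimes>\<^bsub>T\<^esub> act r u"
  using action_by_automorphisms.act_hom[OF crossed_module.axioms(2)[OF crossed_module_axioms]]
  by (auto simp: hom_def)

lemma crossed_act_act:
  "r \<in> carrier R \<Longrightarrow> r' \<in> carrier R \<Longrightarrow> t \<in> carrier T \<Longrightarrow> act r (act r' t) = act (r \<otimes>\<^bsub>R\<^esub> r') t"
  using group_action.composition_rule[OF action_by_automorphisms.axioms(1)
      [OF crossed_module.axioms(2)[OF crossed_module_axioms]]] by simp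

lemma crossed_act_one [simp]: "t \<in> carrier T \<Longrightarrow> act \<one>\<^bsub>R\<^esub> t = t"
  using fun_cong[OF group_action.id_eq_one[OF action_by_automorphisms.axioms(1)
      [OF crossed_module.axioms(2)[OF crossed_module_axioms]]], of t] by simp

lemma crossed_act_unit [simp]: "r \<in> carrier R \<Longrightarrow> act r \<one>\<^bsub>T\<^esub> = \<one>\<^bsub>T\<^esub>"
  by (metis crossed_act_closed crossed_act_mult bd.G.l_cancel_one' bd.G.one_closed bd.G.r_one)

lemma T_inv_mult_cancel [simp]:
  "x \<in> carrier T \<Longrightarrow> y \<in> carrier T \<Longrightarrow> inv\<^bsub>T\<^esub> x \<otimes>\<^bsub>T\<^esub> (x \<otimes>\<^bsub>T\<^esub> y) = y"
  "x \<in> carrier T \<Longrightarrow> y \<in> carrier T \<Longrightarrow> x \<otimes>\<^bsub>T\<^esub> (inv\<^bsub>T\<^esub> x \<otimes>\<^bsub>T\<^esub> y) = y"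
  by (simp_all flip: bd.G.m_assoc)

lemma R_inv_mult_cancel [simp]:
  "x \<in> carrier R \<Longrightarrow> y \<in> carrier R \<Longrightarrow> inv\<^bsub>R\<^esub> x \<otimes>\<^bsub>R\<^esub> (x \<otimes>\<^bsub>R\<^esub> y) = y"
  "x \<in> carrier R \<Longrightarrow> y \<in> carrier R \<Longrightarrow> x \<otimes>\<^bsub>R\<^esub> (inv\<^bsub>R\<^esub> x \<otimes>\<^bsub>R\<^esub> y) = y"
  by (simp_all flip: bd.H.m_assoc)

lemma peiffer_swap:
  "t \<in> carrier T \<Longrightarrow> u \<in> carrier T \<Longrightarrow> act (bd t) u \<otimes>\<^bsub>T\<^esub> t = t \<otimes>\<^bsub>T\<^esub> u"
  by (simp add: peiffer bd.G.m_assoc)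

lemma bd_i [simp]: "m \<in> carrier M \<Longrightarrow> bd (i m) = \<one>\<^bsub>R\<^esub>"
  using exact_T by (auto simp: kernel_def)

lemma p_bd [simp]: "t \<in> carrier T \<Longrightarrow> p (bd t) = \<one>"
  using exact_R by (auto simp: kernel_def)

lemma equal_bd:
  assumes [simp]: "t \<in> carrier T" "u \<in> carrier T" and eq: "bd t = bd u"
  shows "\<exists>m\<in>carrier M. t = i m \<otimes>\<^bsub>T\<^esub> u"
proof -
  have "t \<otimes>\<^bsub>T\<^esub> inv\<^bsub>T\<^esub> u \<in> i ` carrier M"
    by (simp add: exact_T kernel_def eq)
  then obtain m where m: "m \<in> carrier M" "t \<otimes>\<^bsub>T\<^esub> inv\<^bsub>T\<^esub> u = i m"
    by blast
  have "t = i m \<otimes>\<^bsub>T\<^esub> u"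
    by (simp add: bd.G.m_assoc flip: m(2))
  with m(1) show ?thesis
    by blast
qed

lemma equal_p:
  assumes [simp]: "r \<in> carrier R" "r' \<in> carrier R" and eq: "p r = p r'"
  shows "\<exists>t\<in>carrier T. r = bd t \<otimes>\<^bsub>R\<^esub> r'"
proof -
  have "r \<otimes>\<^bsub>R\<^esub> inv\<^bsub>R\<^esub> r' \<in> bd ` carrier T"
    by (simp add: exact_R kernel_def eq)
  then obtain t where t: "t \<in> carrier T" "r \<otimes>\<^bsub>R\<^esub> inv\<^bsub>R\<^esub> r' = bd t"
    by blast
  have "r = bd t \<otimes>\<^bsub>R\<^esub> r'"
    by (simp add: bd.H.m_assoc flip: t(2))
  with t(1) show ?thesis
    by blast
qed

lemma i_eq_iff [simp]: "m \<in> carrier M \<Longrightarrow> n \<in> carrier M \<Longrightarrow> i m = i n \<longleftrightarrow> m = n"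
  using exact_M by (auto dest: inj_onD)

lemma i_central: "m \<in> carrier M \<Longrightarrow> t \<in> carrier T \<Longrightarrow> t \<otimes>\<^bsub>T\<^esub> i m = i m \<otimes>\<^bsub>T\<^esub> t"
  using peiffer_swap[of "i m" t] by simp

lemma i_lcomm:
  "m \<in> carrier M \<Longrightarrow> t \<in> carrier T \<Longrightarrow> u \<in> carrier T
    \<Longrightarrow> t \<otimes>\<^bsub>T\<^esub> (i m \<otimes>\<^bsub>T\<^esub> u) = i m \<otimes>\<^bsub>T\<^esub> (t \<otimes>\<^bsub>T\<^esub> u)"
  by (simp add: i_central flip: bd.G.m_assoc)

abbreviation lifting :: "('a \<Rightarrow> 'g) \<Rightarrow> ('a \<Rightarrow> 'a \<Rightarrow> 'e) \<Rightarrow> bool" where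
  "lifting s \<sigma> \<equiv> lifting_pair G T R bd p s \<sigma>"

text \<open>The cocycle of a lifting, characterised by the identity that it satisfies: \<open>f\<close> measures the
  difference between the two elements of \<open>T\<close> that relate \<open>s x s y s z\<close> to \<open>s (x y z)\<close>.\<close>

definition lifting_defect :: "('a \<Rightarrow> 'g) \<Rightarrow> ('a \<Rightarrow> 'a \<Rightarrow> 'e) \<Rightarrow> ('a \<Rightarrow> 'a \<Rightarrow> 'a \<Rightarrow> 'c) \<Rightarrow> bool" where
  "lifting_defect s \<sigma> f \<longleftrightarrow>
     (\<forall>x\<in>carrier G. \<forall>y\<in>carrier G. \<forall>z\<in>carrier G. f x y z \<in> carrier M \<and>
        act (s x) (\<sigma> y z) \<otimes>\<^bsub>T\<^esub> \<sigma> x (y \<otimes> z) = i (f x y z) \<otimes>\<^bsub>T\<^esub> (\<sigma> x y \<otimes>\<^bsub>T\<^esub> \<sigma> (x \<otimes> y) z))"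

lemma liftingD:
  assumes "lifting s \<sigma>" "x \<in> carrier G"
  shows "s x \<in> carrier R" "p (s x) = x"
    and "y \<in> carrier G \<Longrightarrow> \<sigma> x y \<in> carrier T"
  using assms by (auto simp: lifting_pair_def)

lemma lifting_bd:
  assumes "lifting s \<sigma>" "x \<in> carrier G" "y \<in> carrier G"
  shows "bd (\<sigma> x y) \<otimes>\<^bsub>R\<^esub> s (x \<otimes> y) = s x \<otimes>\<^bsub>R\<^esub> s y"
  using assms by (auto simp: lifting_pair_def)

lemma lifting_defectD:
  assumes "lifting_defect s \<sigma> f" "x \<in> carrier G" "y \<in> carrier G" "z \<in> carrier G"
  shows "f x y z \<in> carrier M"
    and "act (s x) (\<sigma> y z) \<otimes>\<^bsub>T\<^esub> \<sigma> x (y \<otimes> z) = i (f x y z) \<otimes>\<^bsub>T\<^esub> (\<sigma> x y \<otimes>\<^bsub>T\<^esub> \<sigma> (x \<otimes> y) z)"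
  using assms by (auto simp: lifting_defect_def)

lemma lifting_defect_unique:
  assumes l: "lifting s \<sigma>" and f: "lifting_defect s \<sigma> f" "lifting_defect s \<sigma> f'"
    and G: "x \<in> carrier G" "y \<in> carrier G" "z \<in> carrier G"
  shows "f x y z = f' x y z"
proof -
  have "i (f x y z) \<otimes>\<^bsub>T\<^esub> (\<sigma> x y \<otimes>\<^bsub>T\<^esub> \<sigma> (x \<otimes> y) z) = i (f' x y z) \<otimes>\<^bsub>T\<^esub> (\<sigma> x y \<otimes>\<^bsub>T\<^esub> \<sigma> (x \<otimes> y) z)"
    using lifting_defectD(2)[OF f(1) G] lifting_defectD(2)[OF f(2) G] by simp
  then show ?thesis
    using liftingD[OF l] G lifting_defectD(1)[OF f(1) G] lifting_defectD(1)[OF f(2) G] by simp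
qed

lemma lifting_cocycle_defect:
  assumes l: "lifting s \<sigma>"
  shows "lifting_defect s \<sigma> (\<lambda>x y z. lifting_cocycle G M T i act s \<sigma> [x, y, z])"
  unfolding lifting_defect_def
proof (intro ballI)
  fix x y z assume G [simp]: "x \<in> carrier G" "y \<in> carrier G" "z \<in> carrier G"
  note [simp] = liftingD[OF l]
  let ?f = "lifting_cocycle G M T i act s \<sigma> [x, y, z]"
  let ?L = "act (s x) (\<sigma> y z) \<otimes>\<^bsub>T\<^esub> \<sigma> x (y \<otimes> z)" and ?N = "\<sigma> x y \<otimes>\<^bsub>T\<^esub> \<sigma> (x \<otimes> y) z"
  have "bd ?L \<otimes>\<^bsub>R\<^esub> s (x \<otimes> y \<otimes> z) = s x \<otimes>\<^bsub>R\<^esub> bd (\<sigma> y z) \<otimes>\<^bsub>R\<^esub> inv\<^bsub>R\<^esub> s x \<otimes>\<^bsub>R\<^esub> (s x \<otimes>\<^bsub>R\<^esub> s (y \<otimes> z))"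
    using lifting_bd[OF l, of x "y \<otimes> z"] by (simp add: bd_act bd.H.m_assoc base.m_assoc)
  also have "\<dots> = s x \<otimes>\<^bsub>R\<^esub> (bd (\<sigma> y z) \<otimes>\<^bsub>R\<^esub> s (y \<otimes> z))"
    by (simp add: bd.H.m_assoc)
  also have "\<dots> = s x \<otimes>\<^bsub>R\<^esub> s y \<otimes>\<^bsub>R\<^esub> s z"
    by (simp add: lifting_bd[OF l] bd.H.m_assoc)
  also have "\<dots> = bd (\<sigma> x y) \<otimes>\<^bsub>R\<^esub> s (x \<otimes> y) \<otimes>\<^bsub>R\<^esub> s z"
    by (simp only: lifting_bd[OF l] G)
  also have "\<dots> = bd ?N \<otimes>\<^bsub>R\<^esub> s (x \<otimes> y \<otimes> z)"
    using lifting_bd[OF l, of "x \<otimes> y" z] by (simp add: bd.H.m_assoc)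
  finally have "bd ?L = bd ?N"
    by (simp del: bd.hom_mult)
  then obtain m where m: "m \<in> carrier M" "?L = i m \<otimes>\<^bsub>T\<^esub> ?N"
    using equal_bd[of ?L ?N] by auto
  have "?f = inv_into (carrier M) i (?L \<otimes>\<^bsub>T\<^esub> inv\<^bsub>T\<^esub> ?N)"
    by (simp add: lifting_cocycle_def tuples_def bd.G.inv_mult_group bd.G.m_assoc)
  also have "\<dots> = inv_into (carrier M) i (i m)"
    using m by (simp add: bd.G.m_assoc del: i.hom_mult)
  also have "\<dots> = m"
    using m exact_M by simp
  finally show "?f \<in> carrier M \<and> ?L = i ?f \<otimes>\<^bsub>T\<^esub> ?N"
    using m by simp
qed

text \<open>The usual pentagon argument: the element \<open>?A\<close>, which relates \<open>s a s b s c s d\<close> to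
  \<open>s (a b c d)\<close>, is brought in two ways into the form \<open>i m \<otimes> ?W\<close> with \<open>?W\<close> bracketed from the left.\<close>

lemma lifting_defect_cocycle3:
  assumes l: "lifting s \<sigma>" and f: "lifting_defect s \<sigma> f"
  shows "cocycle3 f"
  unfolding cocycle3_def
proof (intro conjI ballI)
  fix a b c assume "a \<in> carrier G" "b \<in> carrier G" "c \<in> carrier G"
  then show "f a b c \<in> carrier M"
    by (rule lifting_defectD(1)[OF f])
next
  fix a b c d assume G [simp]: "a \<in> carrier G" "b \<in> carrier G" "c \<in> carrier G" "d \<in> carrier G"
  note [simp] = liftingD[OF l] lifting_defectD(1)[OF f]
  note D = lifting_defectD(2)[OF f]
  let ?W = "\<sigma> a b \<otimes>\<^bsub>T\<^esub> (\<sigma> (a \<otimes> b) c \<otimes>\<^bsub>T\<^esub> \<sigma> (a \<otimes> b \<otimes> c) d)"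
  let ?A = "act (s a) (act (s b) (\<sigma> c d)) \<otimes>\<^bsub>T\<^esub> act (s a) (\<sigma> b (c \<otimes> d)) \<otimes>\<^bsub>T\<^esub> \<sigma> a (b \<otimes> c \<otimes> d)"
  have "?A = act (s a) (act (s b) (\<sigma> c d) \<otimes>\<^bsub>T\<^esub> \<sigma> b (c \<otimes> d)) \<otimes>\<^bsub>T\<^esub> \<sigma> a (b \<otimes> c \<otimes> d)"
    by (simp add: crossed_act_mult)
  also have "\<dots> = i (actM a (f b c d)) \<otimes>\<^bsub>T\<^esub> (act (s a) (\<sigma> b c) \<otimes>\<^bsub>T\<^esub>
      (act (s a) (\<sigma> (b \<otimes> c) d) \<otimes>\<^bsub>T\<^esub> \<sigma> a (b \<otimes> c \<otimes> d)))"
    using induced_action[of "s a" "f b c d"]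
    by (simp add: D[of b c d] crossed_act_mult bd.G.m_assoc)
  also have "\<dots> = i (actM a (f b c d)) \<otimes>\<^bsub>T\<^esub> (i (f a (b \<otimes> c) d) \<otimes>\<^bsub>T\<^esub>
      ((act (s a) (\<sigma> b c) \<otimes>\<^bsub>T\<^esub> \<sigma> a (b \<otimes> c)) \<otimes>\<^bsub>T\<^esub> \<sigma> (a \<otimes> b \<otimes> c) d))"
    using D[of a "b \<otimes> c" d] by (simp add: i_lcomm[of _ "act (s a) (\<sigma> b c)"] bd.G.m_assoc base.m_assoc)
  also have "\<dots> = i (actM a (f b c d) \<otimes>\<^bsub>M\<^esub> f a (b \<otimes> c) d \<otimes>\<^bsub>M\<^esub> f a b c) \<otimes>\<^bsub>T\<^esub> ?W"
    by (simp add: D[of a b c] bd.G.m_assoc)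
  finally have 1: "?A = i (actM a (f b c d) \<otimes>\<^bsub>M\<^esub> f a (b \<otimes> c) d \<otimes>\<^bsub>M\<^esub> f a b c) \<otimes>\<^bsub>T\<^esub> ?W" .
  have "?A = act (s a) (act (s b) (\<sigma> c d)) \<otimes>\<^bsub>T\<^esub> (act (s a) (\<sigma> b (c \<otimes> d)) \<otimes>\<^bsub>T\<^esub> \<sigma> a (b \<otimes> (c \<otimes> d)))"
    by (simp add: bd.G.m_assoc base.m_assoc)
  also have "\<dots> = i (f a b (c \<otimes> d)) \<otimes>\<^bsub>T\<^esub> (act (s a) (act (s b) (\<sigma> c d)) \<otimes>\<^bsub>T\<^esub> \<sigma> a b \<otimes>\<^bsub>T\<^esub>
      \<sigma> (a \<otimes> b) (c \<otimes> d))"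
    by (simp add: D[of a b "c \<otimes> d"] i_lcomm[of _ "act (s a) (act (s b) (\<sigma> c d))"] bd.G.m_assoc)
  also have "act (s a) (act (s b) (\<sigma> c d)) \<otimes>\<^bsub>T\<^esub> \<sigma> a b = \<sigma> a b \<otimes>\<^bsub>T\<^esub> act (s (a \<otimes> b)) (\<sigma> c d)"
  proof -
    have "act (s a) (act (s b) (\<sigma> c d)) = act (bd (\<sigma> a b)) (act (s (a \<otimes> b)) (\<sigma> c d))"
      by (simp add: crossed_act_act lifting_bd[OF l])
    then show ?thesis
      by (simp add: peiffer_swap)
  qed
  also have "i (f a b (c \<otimes> d)) \<otimes>\<^bsub>T\<^esub> (\<sigma> a b \<otimes>\<^bsub>T\<^esub> act (s (a \<otimes> b)) (\<sigma> c d) \<otimes>\<^bsub>T\<^esub> \<sigma> (a \<otimes> b) (c \<otimes> d))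
      = i (f a b (c \<otimes> d) \<otimes>\<^bsub>M\<^esub> f (a \<otimes> b) c d) \<otimes>\<^bsub>T\<^esub> ?W"
    by (simp add: bd.G.m_assoc D[of "a \<otimes> b" c d] i_lcomm[of _ "\<sigma> a b"])
  finally show "actM a (f b c d) \<otimes>\<^bsub>M\<^esub> f a (b \<otimes> c) d \<otimes>\<^bsub>M\<^esub> f a b c = f a b (c \<otimes> d) \<otimes>\<^bsub>M\<^esub> f (a \<otimes> b) c d"
    unfolding 1 by (simp del: i.hom_mult)
qed

lemma lifting_twist:
  assumes l: "lifting s \<sigma>"
    and \<beta> [simp]: "\<And>x y. x \<in> carrier G \<Longrightarrow> y \<in> carrier G \<Longrightarrow> \<beta> x y \<in> carrier M"
  shows "lifting s (\<lambda>x y. i (\<beta> x y) \<otimes>\<^bsub>T\<^esub> \<sigma> x y)"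
  using l by (auto simp: lifting_pair_def)

lemma lifting_defect_twist:
  assumes l: "lifting s \<sigma>" and f: "lifting_defect s \<sigma> f"
    and \<beta> [simp]: "\<And>x y. x \<in> carrier G \<Longrightarrow> y \<in> carrier G \<Longrightarrow> \<beta> x y \<in> carrier M"
  shows "lifting_defect s (\<lambda>x y. i (\<beta> x y) \<otimes>\<^bsub>T\<^esub> \<sigma> x y) (\<lambda>x y z. cobd2 \<beta> x y z \<otimes>\<^bsub>M\<^esub> f x y z)"
  unfolding lifting_defect_def
proof (intro ballI conjI)
  fix x y z assume G [simp]: "x \<in> carrier G" "y \<in> carrier G" "z \<in> carrier G"
  note [simp] = liftingD[OF l] lifting_defectD(1)[OF f]
  show "cobd2 \<beta> x y z \<otimes>\<^bsub>M\<^esub> f x y z \<in> carrier M"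
    by (simp add: cobd2_closed)
  let ?u = "actM x (\<beta> y z) \<otimes>\<^bsub>M\<^esub> \<beta> x (y \<otimes> z)" and ?v = "\<beta> x y \<otimes>\<^bsub>M\<^esub> \<beta> (x \<otimes> y) z"
  have "act (s x) (i (\<beta> y z) \<otimes>\<^bsub>T\<^esub> \<sigma> y z) \<otimes>\<^bsub>T\<^esub> (i (\<beta> x (y \<otimes> z)) \<otimes>\<^bsub>T\<^esub> \<sigma> x (y \<otimes> z))
      = i ?u \<otimes>\<^bsub>T\<^esub> (act (s x) (\<sigma> y z) \<otimes>\<^bsub>T\<^esub> \<sigma> x (y \<otimes> z))"
    using induced_action[of "s x" "\<beta> y z"]
    by (simp add: crossed_act_mult bd.G.m_assoc i_lcomm[of _ "act (s x) (\<sigma> y z)"])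
  also have "\<dots> = i (?u \<otimes>\<^bsub>M\<^esub> f x y z) \<otimes>\<^bsub>T\<^esub> (\<sigma> x y \<otimes>\<^bsub>T\<^esub> \<sigma> (x \<otimes> y) z)"
    by (simp add: lifting_defectD(2)[OF f] bd.G.m_assoc)
  also have "?u \<otimes>\<^bsub>M\<^esub> f x y z = cobd2 \<beta> x y z \<otimes>\<^bsub>M\<^esub> f x y z \<otimes>\<^bsub>M\<^esub> ?v"
  proof -
    have "cobd2 \<beta> x y z \<otimes>\<^bsub>M\<^esub> f x y z \<otimes>\<^bsub>M\<^esub> ?v = ?u \<otimes>\<^bsub>M\<^esub> f x y z \<otimes>\<^bsub>M\<^esub> (inv\<^bsub>M\<^esub> ?v \<otimes>\<^bsub>M\<^esub> ?v)"
      unfolding cobd2_def by (simp add: m_ac del: l_inv)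
    then show ?thesis
      by simp
  qed
  also have "i (cobd2 \<beta> x y z \<otimes>\<^bsub>M\<^esub> f x y z \<otimes>\<^bsub>M\<^esub> ?v) \<otimes>\<^bsub>T\<^esub> (\<sigma> x y \<otimes>\<^bsub>T\<^esub> \<sigma> (x \<otimes> y) z)
      = i (cobd2 \<beta> x y z \<otimes>\<^bsub>M\<^esub> f x y z) \<otimes>\<^bsub>T\<^esub>
        (i (\<beta> x y) \<otimes>\<^bsub>T\<^esub> \<sigma> x y \<otimes>\<^bsub>T\<^esub> (i (\<beta> (x \<otimes> y) z) \<otimes>\<^bsub>T\<^esub> \<sigma> (x \<otimes> y) z))"
    by (simp add: cobd2_closed bd.G.m_assoc i_lcomm[of _ "\<sigma> x y"])
  finally show "act (s x) (i (\<beta> y z) \<otimes>\<^bsub>T\<^esub> \<sigma> y z) \<otimes>\<^bsub>T\<^esub> (i (\<beta> x (y \<otimes> z)) \<otimes>\<^bsub>T\<^esub> \<sigma> x (y \<otimes> z))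
      = i (cobd2 \<beta> x y z \<otimes>\<^bsub>M\<^esub> f x y z) \<otimes>\<^bsub>T\<^esub>
        (i (\<beta> x y) \<otimes>\<^bsub>T\<^esub> \<sigma> x y \<otimes>\<^bsub>T\<^esub> (i (\<beta> (x \<otimes> y) z) \<otimes>\<^bsub>T\<^esub> \<sigma> (x \<otimes> y) z))" .
qed

text \<open>Two sections of \<open>p\<close> differ by the boundaries of elements \<open>t x\<close> of \<open>T\<close>. Transporting \<open>\<sigma>\<close> along \<open>t\<close>
  does not change the cocycle at all.\<close>

lemma lifting_change_section:
  assumes l: "lifting s \<sigma>" and f: "lifting_defect s \<sigma> f"
    and t [simp]: "\<And>x. x \<in> carrier G \<Longrightarrow> t x \<in> carrier T"
    and s': "\<And>x. x \<in> carrier G \<Longrightarrow> s' x = bd (t x) \<otimes>\<^bsub>R\<^esub> s x"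
  defines "\<sigma>' \<equiv> \<lambda>x y. t x \<otimes>\<^bsub>T\<^esub> act (s x) (t y) \<otimes>\<^bsub>T\<^esub> \<sigma> x y \<otimes>\<^bsub>T\<^esub> inv\<^bsub>T\<^esub> (t (x \<otimes> y))"
  shows "lifting s' \<sigma>'" and "lifting_defect s' \<sigma>' f"
proof -
  note [simp] = liftingD[OF l] lifting_defectD(1)[OF f]
  show "lifting s' \<sigma>'"
    unfolding lifting_pair_def
  proof (intro conjI ballI)
    fix x y assume [simp]: "x \<in> carrier G" "y \<in> carrier G"
    have "bd (\<sigma>' x y) \<otimes>\<^bsub>R\<^esub> s' (x \<otimes> y)
        = bd (t x) \<otimes>\<^bsub>R\<^esub> bd (act (s x) (t y)) \<otimes>\<^bsub>R\<^esub> (bd (\<sigma> x y) \<otimes>\<^bsub>R\<^esub> s (x \<otimes> y))"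
      by (simp add: \<sigma>'_def s' bd.H.m_assoc)
    also have "\<dots> = s' x \<otimes>\<^bsub>R\<^esub> s' y"
      by (simp add: lifting_bd[OF l] s' bd_act bd.H.m_assoc)
    finally show "s' x \<otimes>\<^bsub>R\<^esub> s' y = bd (\<sigma>' x y) \<otimes>\<^bsub>R\<^esub> s' (x \<otimes> y)"
      by simp
  qed (simp_all add: s' \<sigma>'_def)
  show "lifting_defect s' \<sigma>' f"
    unfolding lifting_defect_def
  proof (intro ballI conjI)
    fix x y z assume [simp]: "x \<in> carrier G" "y \<in> carrier G" "z \<in> carrier G"
    have "act (s' x) (\<sigma>' y z) \<otimes>\<^bsub>T\<^esub> \<sigma>' x (y \<otimes> z)
        = act (bd (t x)) (act (s x) (\<sigma>' y z)) \<otimes>\<^bsub>T\<^esub> t x \<otimes>\<^bsub>T\<^esub>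
          (act (s x) (t (y \<otimes> z)) \<otimes>\<^bsub>T\<^esub> \<sigma> x (y \<otimes> z) \<otimes>\<^bsub>T\<^esub> inv\<^bsub>T\<^esub> (t (x \<otimes> y \<otimes> z)))"
      by (simp add: \<sigma>'_def s' crossed_act_act bd.G.m_assoc base.m_assoc)
    also have "\<dots> = t x \<otimes>\<^bsub>T\<^esub> (act (s x) (\<sigma>' y z) \<otimes>\<^bsub>T\<^esub> act (s x) (t (y \<otimes> z))) \<otimes>\<^bsub>T\<^esub>
        \<sigma> x (y \<otimes> z) \<otimes>\<^bsub>T\<^esub> inv\<^bsub>T\<^esub> (t (x \<otimes> y \<otimes> z))"
      by (subst peiffer_swap) (simp_all add: \<sigma>'_def bd.G.m_assoc)
    also have "act (s x) (\<sigma>' y z) \<otimes>\<^bsub>T\<^esub> act (s x) (t (y \<otimes> z))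
        = act (s x) (t y) \<otimes>\<^bsub>T\<^esub> act (s x) (act (s y) (t z)) \<otimes>\<^bsub>T\<^esub> act (s x) (\<sigma> y z)"
      by (simp add: \<sigma>'_def bd.G.m_assoc flip: crossed_act_mult)
    also have "act (s x) (act (s y) (t z)) = act (bd (\<sigma> x y)) (act (s (x \<otimes> y)) (t z))"
      by (simp add: crossed_act_act lifting_bd[OF l])
    also have "t x \<otimes>\<^bsub>T\<^esub>
          (act (s x) (t y) \<otimes>\<^bsub>T\<^esub> act (bd (\<sigma> x y)) (act (s (x \<otimes> y)) (t z)) \<otimes>\<^bsub>T\<^esub> act (s x) (\<sigma> y z)) \<otimes>\<^bsub>T\<^esub>
          \<sigma> x (y \<otimes> z) \<otimes>\<^bsub>T\<^esub> inv\<^bsub>T\<^esub> (t (x \<otimes> y \<otimes> z))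
        = t x \<otimes>\<^bsub>T\<^esub> act (s x) (t y) \<otimes>\<^bsub>T\<^esub> act (bd (\<sigma> x y)) (act (s (x \<otimes> y)) (t z)) \<otimes>\<^bsub>T\<^esub>
          (act (s x) (\<sigma> y z) \<otimes>\<^bsub>T\<^esub> \<sigma> x (y \<otimes> z)) \<otimes>\<^bsub>T\<^esub> inv\<^bsub>T\<^esub> (t (x \<otimes> y \<otimes> z))"
      by (simp add: bd.G.m_assoc)
    also have "\<dots> = i (f x y z) \<otimes>\<^bsub>T\<^esub> (t x \<otimes>\<^bsub>T\<^esub> act (s x) (t y) \<otimes>\<^bsub>T\<^esub>
          (act (bd (\<sigma> x y)) (act (s (x \<otimes> y)) (t z)) \<otimes>\<^bsub>T\<^esub> \<sigma> x y) \<otimes>\<^bsub>T\<^esub> \<sigma> (x \<otimes> y) z \<otimes>\<^bsub>T\<^esub>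
          inv\<^bsub>T\<^esub> (t (x \<otimes> y \<otimes> z)))"
      by (simp add: lifting_defectD(2)[OF f] bd.G.m_assoc
          i_lcomm[of _ "act (bd (\<sigma> x y)) (act (s (x \<otimes> y)) (t z))"]
          i_lcomm[of _ "act (s x) (t y)"] i_lcomm[of _ "t x"])
    also have "\<dots> = i (f x y z) \<otimes>\<^bsub>T\<^esub> (\<sigma>' x y \<otimes>\<^bsub>T\<^esub> \<sigma>' (x \<otimes> y) z)"
      by (subst peiffer_swap) (simp_all add: \<sigma>'_def bd.G.m_assoc)
    finally show "act (s' x) (\<sigma>' y z) \<otimes>\<^bsub>T\<^esub> \<sigma>' x (y \<otimes> z)
        = i (f x y z) \<otimes>\<^bsub>T\<^esub> (\<sigma>' x y \<otimes>\<^bsub>T\<^esub> \<sigma>' (x \<otimes> y) z)" .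
  qed simp
qed

lemma lifting_same_section:
  assumes l: "lifting s \<sigma>" and l': "lifting s \<sigma>'"
  obtains \<beta> where "\<And>x y. x \<in> carrier G \<Longrightarrow> y \<in> carrier G \<Longrightarrow> \<beta> x y \<in> carrier M"
    and "\<And>x y. x \<in> carrier G \<Longrightarrow> y \<in> carrier G \<Longrightarrow> \<sigma>' x y = i (\<beta> x y) \<otimes>\<^bsub>T\<^esub> \<sigma> x y"
proof -
  have "\<exists>m. m \<in> carrier M \<and> \<sigma>' x y = i m \<otimes>\<^bsub>T\<^esub> \<sigma> x y"
    if [simp]: "x \<in> carrier G" "y \<in> carrier G" for x y
  proof -
    note [simp] = liftingD[OF l] liftingD[OF l']
    have "bd (\<sigma>' x y) = bd (\<sigma> x y)"
      using lifting_bd[OF l, of x y] lifting_bd[OF l', of x y] by (metis l bd.H.r_cancel bd.hom_closed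
          base.m_closed liftingD(1) liftingD(3) l' that)
    then show ?thesis
      using equal_bd[of "\<sigma>' x y" "\<sigma> x y"] by auto
  qed
  then have "\<exists>\<beta>. \<forall>x y. x \<in> carrier G \<longrightarrow> y \<in> carrier G \<longrightarrow>
      \<beta> x y \<in> carrier M \<and> \<sigma>' x y = i (\<beta> x y) \<otimes>\<^bsub>T\<^esub> \<sigma> x y"
    by metis
  then show ?thesis
    using that by blast
qed

lemma lifting_defect_cong:
  assumes f: "lifting_defect s \<sigma> f"
    and "\<And>x y. x \<in> carrier G \<Longrightarrow> y \<in> carrier G \<Longrightarrow> \<sigma>' x y = \<sigma> x y"
    and "\<And>x y z. x \<in> carrier G \<Longrightarrow> y \<in> carrier G \<Longrightarrow> z \<in> carrier G \<Longrightarrow> f' x y z = f x y z"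
  shows "lifting_defect s \<sigma>' f'"
  using assms by (simp add: lifting_defect_def)

lemma lifting_defect_cohomologous:
  assumes l: "lifting s \<sigma>" and f: "lifting_defect s \<sigma> f"
    and l': "lifting s' \<sigma>'" and f': "lifting_defect s' \<sigma>' f'"
  obtains \<beta> where "\<And>x y. x \<in> carrier G \<Longrightarrow> y \<in> carrier G \<Longrightarrow> \<beta> x y \<in> carrier M"
    and "\<And>x y z. x \<in> carrier G \<Longrightarrow> y \<in> carrier G \<Longrightarrow> z \<in> carrier G
      \<Longrightarrow> f' x y z = cobd2 \<beta> x y z \<otimes>\<^bsub>M\<^esub> f x y z"
proof -
  note [simp] = liftingD[OF l] liftingD[OF l']
  have "\<exists>u. u \<in> carrier T \<and> s' x = bd u \<otimes>\<^bsub>R\<^esub> s x" if [simp]: "x \<in> carrier G" for x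
    using equal_p[of "s' x" "s x"] by auto
  then obtain t where t: "\<And>x. x \<in> carrier G \<Longrightarrow> t x \<in> carrier T"
      "\<And>x. x \<in> carrier G \<Longrightarrow> s' x = bd (t x) \<otimes>\<^bsub>R\<^esub> s x"
    by metis
  define \<tau> where "\<tau> = (\<lambda>x y. t x \<otimes>\<^bsub>T\<^esub> act (s x) (t y) \<otimes>\<^bsub>T\<^esub> \<sigma> x y \<otimes>\<^bsub>T\<^esub> inv\<^bsub>T\<^esub> (t (x \<otimes> y)))"
  have \<tau>: "lifting s' \<tau>" "lifting_defect s' \<tau> f"
    unfolding \<tau>_def by (rule lifting_change_section[OF l f t]; assumption)+
  obtain \<beta> where \<beta>: "\<And>x y. x \<in> carrier G \<Longrightarrow> y \<in> carrier G \<Longrightarrow> \<beta> x y \<in> carrier M"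
      "\<And>x y. x \<in> carrier G \<Longrightarrow> y \<in> carrier G \<Longrightarrow> \<sigma>' x y = i (\<beta> x y) \<otimes>\<^bsub>T\<^esub> \<tau> x y"
    by (rule lifting_same_section[OF \<tau>(1) l']) blast
  have "lifting_defect s' \<sigma>' (\<lambda>x y z. cobd2 \<beta> x y z \<otimes>\<^bsub>M\<^esub> f x y z)"
    by (rule lifting_defect_cong[OF lifting_defect_twist[OF \<tau> \<beta>(1)]]) (simp_all add: \<beta>(2))
  from lifting_defect_unique[OF l' f' this] show ?thesis
    using that \<beta>(1) by blast
qed

lemma normalised_lifting_exists:
  obtains s \<sigma> where "lifting s \<sigma>" "s \<one> = \<one>\<^bsub>R\<^esub>"
proof -
  have "\<exists>r. r \<in> carrier R \<and> p r = x \<and> (x = \<one> \<longrightarrow> r = \<one>\<^bsub>R\<^esub>)" if "x \<in> carrier G" for x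
    using that exact_G by (metis bd.H.one_closed imageE p.hom_one)
  then obtain s where s [simp]: "\<And>x. x \<in> carrier G \<Longrightarrow> s x \<in> carrier R"
      "\<And>x. x \<in> carrier G \<Longrightarrow> p (s x) = x" and s1: "s \<one> = \<one>\<^bsub>R\<^esub>"
    by (metis base.one_closed)
  have "\<exists>t. t \<in> carrier T \<and> s x \<otimes>\<^bsub>R\<^esub> s y = bd t \<otimes>\<^bsub>R\<^esub> s (x \<otimes> y)"
    if [simp]: "x \<in> carrier G" "y \<in> carrier G" for x y
    using equal_p[of "s x \<otimes>\<^bsub>R\<^esub> s y" "s (x \<otimes> y)"] by auto
  then have "\<exists>\<sigma>. \<forall>x y. x \<in> carrier G \<longrightarrow> y \<in> carrier G \<longrightarrow>
      \<sigma> x y \<in> carrier T \<and> s x \<otimes>\<^bsub>R\<^esub> s y = bd (\<sigma> x y) \<otimes>\<^bsub>R\<^esub> s (x \<otimes> y)"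
    by metis
  then obtain \<sigma> where "lifting s \<sigma>"
    by (auto simp: lifting_pair_def)
  with s1 show ?thesis
    using that by blast
qed

end

section \<open>Symmetric liftings\<close>

context crossed_extension
begin

text \<open>A normalised lifting that satisfies the two identities of a symmetric functor, read off in \<open>T\<close>.\<close>

definition symmetric_lifting :: "('a \<Rightarrow> 'g) \<Rightarrow> ('a \<Rightarrow> 'a \<Rightarrow> 'e) \<Rightarrow> bool" where
  "symmetric_lifting s \<sigma> \<longleftrightarrow>
     lifting s \<sigma> \<and> s \<one> = \<one>\<^bsub>R\<^esub> \<and>
     (\<forall>x\<in>carrier G. \<sigma> \<one> x = \<one>\<^bsub>T\<^esub> \<and> \<sigma> x \<one> = \<one>\<^bsub>T\<^esub>) \<and>
     (\<forall>x\<in>carrier G. \<forall>y\<in>carrier G.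
        \<sigma> x y \<otimes>\<^bsub>T\<^esub> \<sigma> (x \<otimes> y) (inv y) = act (s x) (\<sigma> y (inv y)) \<and>
        act (s x) (\<sigma> (inv x) y) \<otimes>\<^bsub>T\<^esub> \<sigma> x (inv x \<otimes> y) = \<sigma> x (inv x))"

lemma symmetric_lifting_defect:
  assumes sl: "symmetric_lifting s \<sigma>" and f: "lifting_defect s \<sigma> f"
  shows "symmetric3 f"
proof (rule symmetric3_of_cocycle3)
  have l: "lifting s \<sigma>" and [simp]: "s \<one> = \<one>\<^bsub>R\<^esub>"
    and [simp]: "\<And>x. x \<in> carrier G \<Longrightarrow> \<sigma> \<one> x = \<one>\<^bsub>T\<^esub>" "\<And>x. x \<in> carrier G \<Longrightarrow> \<sigma> x \<one> = \<one>\<^bsub>T\<^esub>"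
    and right: "\<And>x y. x \<in> carrier G \<Longrightarrow> y \<in> carrier G
      \<Longrightarrow> \<sigma> x y \<otimes>\<^bsub>T\<^esub> \<sigma> (x \<otimes> y) (inv y) = act (s x) (\<sigma> y (inv y))"
    and left: "\<And>x y. x \<in> carrier G \<Longrightarrow> y \<in> carrier G
      \<Longrightarrow> act (s x) (\<sigma> (inv x) y) \<otimes>\<^bsub>T\<^esub> \<sigma> x (inv x \<otimes> y) = \<sigma> x (inv x)"
    using sl by (simp_all add: symmetric_lifting_def)
  note [simp] = liftingD[OF l] lifting_defectD(1)[OF f]
  have D: "f x y z = \<one>\<^bsub>M\<^esub>"
    if "act (s x) (\<sigma> y z) \<otimes>\<^bsub>T\<^esub> \<sigma> x (y \<otimes> z) = \<sigma> x y \<otimes>\<^bsub>T\<^esub> \<sigma> (x \<otimes> y) z"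
      and [simp]: "x \<in> carrier G" "y \<in> carrier G" "z \<in> carrier G" for x y z
  proof -
    have "i (f x y z) \<otimes>\<^bsub>T\<^esub> (\<sigma> x y \<otimes>\<^bsub>T\<^esub> \<sigma> (x \<otimes> y) z) = \<sigma> x y \<otimes>\<^bsub>T\<^esub> \<sigma> (x \<otimes> y) z"
      using lifting_defectD(2)[OF f, of x y z] that(1) by simp
    then have "i (f x y z) = i \<one>\<^bsub>M\<^esub>"
      by simp
    then show ?thesis
      by (simp del: i.hom_one)
  qed
  show "cocycle3 f"
    by (rule lifting_defect_cocycle3[OF l f])
  show "normalised3 f"
    unfolding normalised3_def by (intro ballI conjI; rule D; simp)
  show "f x (inv x) y = \<one>\<^bsub>M\<^esub>" if "x \<in> carrier G" "y \<in> carrier G" for x y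
    using that by (intro D) (simp_all add: left)
  show "f x y (inv y) = \<one>\<^bsub>M\<^esub>" if "x \<in> carrier G" "y \<in> carrier G" for x y
    using that by (intro D) (simp_all add: right)
qed

text \<open>Vanishing of \<open>f\<close> at \<open>(1, 1, x)\<close> and \<open>(x, 1, 1)\<close> forces \<open>\<sigma> \<one> x = i m\<close> and \<open>\<sigma> x \<one> = i (x m)\<close> for a single
  \<open>m\<close>. These are the values of the 2-cocycle \<open>(x, y) \<mapsto> x m\<close>, by which \<open>\<sigma>\<close> can be divided without
  changing \<open>f\<close>.\<close>

lemma symmetric_lifting_of_defect:
  assumes l: "lifting s \<sigma>" and s1 [simp]: "s \<one> = \<one>\<^bsub>R\<^esub>" and f: "lifting_defect s \<sigma> f"
    and f1: "\<And>x. x \<in> carrier G \<Longrightarrow> f \<one> \<one> x = \<one>\<^bsub>M\<^esub>" "\<And>x. x \<in> carrier G \<Longrightarrow> f x \<one> \<one> = \<one>\<^bsub>M\<^esub>"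
    and left: "\<And>x y. x \<in> carrier G \<Longrightarrow> y \<in> carrier G \<Longrightarrow> f x (inv x) y = \<one>\<^bsub>M\<^esub>"
    and right: "\<And>x y. x \<in> carrier G \<Longrightarrow> y \<in> carrier G \<Longrightarrow> f x y (inv y) = \<one>\<^bsub>M\<^esub>"
  obtains \<sigma>' where "symmetric_lifting s \<sigma>'"
proof -
  note [simp] = liftingD[OF l] lifting_defectD(1)[OF f]
  have "bd (\<sigma> \<one> \<one>) = bd \<one>\<^bsub>T\<^esub>"
    using lifting_bd[OF l, of \<one> \<one>] by simp
  then obtain m where m [simp]: "m \<in> carrier M" and \<sigma>11: "\<sigma> \<one> \<one> = i m"
    using equal_bd[of "\<sigma> \<one> \<one>" "\<one>\<^bsub>T\<^esub>"] by auto
  have \<sigma>1: "\<sigma> \<one> x = i m" if [simp]: "x \<in> carrier G" for x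
    using lifting_defectD(2)[OF f, of \<one> \<one> x] by (simp add: f1 \<sigma>11)
  have \<sigma>2: "\<sigma> x \<one> = i (actM x m)" if [simp]: "x \<in> carrier G" for x
    using lifting_defectD(2)[OF f, of x \<one> \<one>] induced_action[of "s x" m] by (simp add: f1 \<sigma>11)
  define \<beta> where "\<beta> x y = inv\<^bsub>M\<^esub> (actM x m)" for x y :: 'a
  have \<beta> [simp]: "\<beta> x y \<in> carrier M" if "x \<in> carrier G" for x y
    using that by (simp add: \<beta>_def)
  have cobd: "cobd2 \<beta> x y z = \<one>\<^bsub>M\<^esub>" if "x \<in> carrier G" "y \<in> carrier G" "z \<in> carrier G" for x y z
    using that by (simp add: cobd2_def \<beta>_def act_inv act_act m_comm)
  define \<sigma>' where "\<sigma>' x y = i (\<beta> x y) \<otimes>\<^bsub>T\<^esub> \<sigma> x y" for x y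
  have l': "lifting s \<sigma>'"
    unfolding \<sigma>'_def by (rule lifting_twist[OF l]) simp
  have f': "lifting_defect s \<sigma>' f"
    by (rule lifting_defect_cong[OF lifting_defect_twist[OF l f, of \<beta>]]) (simp_all add: \<sigma>'_def cobd)
  note [simp] = liftingD[OF l']
  have \<sigma>'1 [simp]: "\<sigma>' \<one> x = \<one>\<^bsub>T\<^esub>" "\<sigma>' x \<one> = \<one>\<^bsub>T\<^esub>" if "x \<in> carrier G" for x
    using that by (simp_all add: \<sigma>'_def \<beta>_def \<sigma>1 \<sigma>2 flip: i.hom_mult)
  have "symmetric_lifting s \<sigma>'"
    unfolding symmetric_lifting_def
  proof (intro conjI ballI l' s1)
    fix x y assume [simp]: "x \<in> carrier G" "y \<in> carrier G"
    show "\<sigma>' x y \<otimes>\<^bsub>T\<^esub> \<sigma>' (x \<otimes> y) (inv y) = act (s x) (\<sigma>' y (inv y))"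
      using lifting_defectD(2)[OF f', of x y "inv y"] by (simp add: right)
    show "act (s x) (\<sigma>' (inv x) y) \<otimes>\<^bsub>T\<^esub> \<sigma>' x (inv x \<otimes> y) = \<sigma>' x (inv x)"
      using lifting_defectD(2)[OF f', of x "inv x" y] by (simp add: left)
  qed simp_all
  then show ?thesis
    by (rule that)
qed

text \<open>From right to left, the symmetric cocycle is first made to vanish at degenerate arguments by means
  of \<open>degenerate_cobounding\<close>. Symmetry of the result is
  not needed any more, only its vanishing.\<close>

theorem symmetric_lifting_iff:
  assumes l: "lifting s \<sigma>" and s1: "s \<one> = \<one>\<^bsub>R\<^esub>" and f: "lifting_defect s \<sigma> f"
  shows "(\<exists>s \<sigma>. symmetric_lifting s \<sigma>) \<longleftrightarrow>
    (\<exists>\<beta>. (\<forall>x\<in>carrier G. \<forall>y\<in>carrier G. \<beta> x y \<in> carrier M) \<and>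
      cocycle3 (\<lambda>x y z. cobd2 \<beta> x y z \<otimes>\<^bsub>M\<^esub> f x y z) \<and>
      symmetric3 (\<lambda>x y z. cobd2 \<beta> x y z \<otimes>\<^bsub>M\<^esub> f x y z))" (is "_ \<longleftrightarrow> ?R")
proof
  assume "\<exists>s \<sigma>. symmetric_lifting s \<sigma>"
  then obtain s' \<sigma>' where sl: "symmetric_lifting s' \<sigma>'"
    by blast
  then have l': "lifting s' \<sigma>'"
    by (simp add: symmetric_lifting_def)
  note f' = lifting_cocycle_defect[OF l']
  obtain \<beta> where \<beta>: "\<And>x y. x \<in> carrier G \<Longrightarrow> y \<in> carrier G \<Longrightarrow> \<beta> x y \<in> carrier M"
    and eq: "\<And>x y z. x \<in> carrier G \<Longrightarrow> y \<in> carrier G \<Longrightarrow> z \<in> carrier G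
      \<Longrightarrow> lifting_cocycle G M T i act s' \<sigma>' [x, y, z] = cobd2 \<beta> x y z \<otimes>\<^bsub>M\<^esub> f x y z"
    using lifting_defect_cohomologous[OF l f l' f'] by blast
  have "lifting_defect s' \<sigma>' (\<lambda>x y z. cobd2 \<beta> x y z \<otimes>\<^bsub>M\<^esub> f x y z)"
    by (rule lifting_defect_cong[OF f']) (simp_all add: eq)
  then show ?R
    using \<beta> lifting_defect_cocycle3[OF l'] symmetric_lifting_defect[OF sl] by blast
next
  assume ?R
  then obtain \<beta> where \<beta>: "\<And>x y. x \<in> carrier G \<Longrightarrow> y \<in> carrier G \<Longrightarrow> \<beta> x y \<in> carrier M"
    and c: "cocycle3 (\<lambda>x y z. cobd2 \<beta> x y z \<otimes>\<^bsub>M\<^esub> f x y z)"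
    and sym: "symmetric3 (\<lambda>x y z. cobd2 \<beta> x y z \<otimes>\<^bsub>M\<^esub> f x y z)"
    by blast
  let ?f = "\<lambda>x y z. cobd2 \<beta> x y z \<otimes>\<^bsub>M\<^esub> f x y z"
  have l1: "lifting s (\<lambda>x y. i (\<beta> x y) \<otimes>\<^bsub>T\<^esub> \<sigma> x y)" (is "lifting s ?\<sigma>")
    by (rule lifting_twist[OF l \<beta>])
  have f1: "lifting_defect s ?\<sigma> ?f"
    by (rule lifting_defect_twist[OF l f \<beta>])
  let ?\<psi> = "degenerate_cobounding ?f"
  have \<psi>: "?\<psi> x y \<in> carrier M" if "x \<in> carrier G" "y \<in> carrier G" for x y
    using that c by (simp add: degenerate_cobounding_def cocycle3_def)
  note cobd = cobd2_degenerate_cobounding[OF c sym]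
  obtain \<tau> where "symmetric_lifting s \<tau>"
    by (rule symmetric_lifting_of_defect[OF lifting_twist[OF l1, of ?\<psi>] s1
          lifting_defect_twist[OF l1 f1, of ?\<psi>]])
      (auto intro: \<psi> cobd)
  then show "\<exists>s \<sigma>. symmetric_lifting s \<sigma>"
    by blast
qed

end

section \<open>Cohomology classes in degree three\<close>

lemma ball_tuples2: "(\<forall>gs\<in>tuples G 2. P gs) \<longleftrightarrow> (\<forall>x\<in>carrier G. \<forall>y\<in>carrier G. P [x, y])"
  by (auto simp: tuples_def length_Suc_conv numeral_2_eq_2)

lemma ball_tuples3:
  "(\<forall>gs\<in>tuples G 3. P gs) \<longleftrightarrow> (\<forall>x\<in>carrier G. \<forall>y\<in>carrier G. \<forall>z\<in>carrier G. P [x, y, z])"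
  by (auto simp: tuples_def length_Suc_conv numeral_3_eq_3)

lemma ball_tuples4:
  "(\<forall>gs\<in>tuples G 4. P gs) \<longleftrightarrow>
     (\<forall>x\<in>carrier G. \<forall>y\<in>carrier G. \<forall>z\<in>carrier G. \<forall>w\<in>carrier G. P [x, y, z, w])"
  by (auto simp: tuples_def length_Suc_conv eval_nat_numeral)

context group_module
begin

lemma cochains_eqI:
  assumes "\<phi> \<in> carrier (cochains G M n)" "\<psi> \<in> carrier (cochains G M n)"
    and "\<And>gs. gs \<in> tuples G n \<Longrightarrow> \<phi> gs = \<psi> gs"
  shows "\<phi> = \<psi>"
  using assms by (auto simp: cochains_def intro: PiE_ext)

lemma cochains_closed:
  "\<phi> \<in> carrier (cochains G M n) \<Longrightarrow> set gs \<subseteq> carrier G \<Longrightarrow> length gs = n \<Longrightarrow> \<phi> gs \<in> carrier M"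
  by (auto simp: cochains_def tuples_def)

lemma coboundary2:
  assumes \<phi>: "\<phi> \<in> carrier (cochains G M 2)" and [simp]: "x \<in> carrier G" "y \<in> carrier G" "z \<in> carrier G"
  shows "coboundary G M act 2 \<phi> [x, y, z] = cobd2 (\<lambda>x y. \<phi> [x, y]) x y z"
proof -
  have [simp]: "\<phi> [a, b] \<in> carrier M" if "a \<in> carrier G" "b \<in> carrier G" for a b
    using cochains_closed[OF \<phi>, of "[a, b]"] that by simp
  have *: "{1..2::nat} = {1, 2}"
    by auto
  show ?thesis
    unfolding coboundary_def * by (simp add: cobd2_def tuples_def int_pow_neg inv_mult m_ac)
qed

lemma coboundary3:
  assumes \<phi>: "\<phi> \<in> carrier (cochains G M 3)"
    and [simp]: "a \<in> carrier G" "b \<in> carrier G" "c \<in> carrier G" "d \<in> carrier G"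
  shows "coboundary G M act 3 \<phi> [a, b, c, d] =
    act a (\<phi> [b, c, d]) \<otimes>\<^bsub>M\<^esub> \<phi> [a, b \<otimes> c, d] \<otimes>\<^bsub>M\<^esub> \<phi> [a, b, c] \<otimes>\<^bsub>M\<^esub>
      inv\<^bsub>M\<^esub> (\<phi> [a, b, c \<otimes> d] \<otimes>\<^bsub>M\<^esub> \<phi> [a \<otimes> b, c, d])"
proof -
  have [simp]: "\<phi> [a, b, c] \<in> carrier M" if "a \<in> carrier G" "b \<in> carrier G" "c \<in> carrier G" for a b c
    using cochains_closed[OF \<phi>, of "[a, b, c]"] that by simp
  have *: "{1..3::nat} = {1, 2, 3}"
    by auto
  show ?thesis
    unfolding coboundary_def * by (simp add: tuples_def int_pow_neg inv_mult m_ac)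
qed

lemma coboundary_closed:
  assumes "\<phi> \<in> carrier (cochains G M 2)"
  shows "coboundary G M act 2 \<phi> \<in> carrier (cochains G M 3)"
proof -
  have "\<forall>gs\<in>tuples G 3. coboundary G M act 2 \<phi> gs \<in> carrier M"
    unfolding ball_tuples3 using cochains_closed[OF assms] by (simp add: coboundary2[OF assms] cobd2_closed)
  then show ?thesis
    by (auto simp: cochains_def coboundary_def numeral_3_eq_3 numeral_2_eq_2)
qed

lemma cohomology_class3:
  assumes f: "f \<in> carrier (cochains G M 3)"
  shows "cohomology_class G M act 3 f = {f' \<in> carrier (cochains G M 3).
    \<exists>\<beta>. (\<forall>x\<in>carrier G. \<forall>y\<in>carrier G. \<beta> x y \<in> carrier M) \<and>
      (\<forall>x\<in>carrier G. \<forall>y\<in>carrier G. \<forall>z\<in>carrier G. f' [x, y, z] = cobd2 \<beta> x y z \<otimes>\<^bsub>M\<^esub> f [x, y, z])}"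
    (is "_ = ?S")
proof -
  have class_eq: "cohomology_class G M act 3 f =
      {coboundary G M act 2 \<phi> \<otimes>\<^bsub>cochains G M 3\<^esub> f |\<phi>. \<phi> \<in> carrier (cochains G M 2)}"
    by (auto simp: cohomology_class_def coboundaries_def r_coset_def numeral_3_eq_3 numeral_2_eq_2)
  have mult: "(\<phi> \<otimes>\<^bsub>cochains G M 3\<^esub> f) [x, y, z] = \<phi> [x, y, z] \<otimes>\<^bsub>M\<^esub> f [x, y, z]"
    if "x \<in> carrier G" "y \<in> carrier G" "z \<in> carrier G" for \<phi> x y z
    using that by (simp add: cochains_def tuples_def)
  have mult_closed: "\<phi> \<otimes>\<^bsub>cochains G M 3\<^esub> f \<in> carrier (cochains G M 3)"
    if "\<phi> \<in> carrier (cochains G M 3)" for \<phi>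
    using that f by (auto simp: cochains_def)
  show ?thesis
  proof (intro equalityI subsetI)
    fix f' assume "f' \<in> cohomology_class G M act 3 f"
    then obtain \<phi> where \<phi>: "\<phi> \<in> carrier (cochains G M 2)"
        "f' = coboundary G M act 2 \<phi> \<otimes>\<^bsub>cochains G M 3\<^esub> f"
      by (auto simp: class_eq)
    then show "f' \<in> ?S"
      using cochains_closed[OF \<phi>(1)]
      by (auto intro!: mult_closed coboundary_closed exI[of _ "\<lambda>x y. \<phi> [x, y]"] simp: mult coboundary2)
  next
    fix f' assume "f' \<in> ?S"
    then obtain \<beta> where f': "f' \<in> carrier (cochains G M 3)"
      and \<beta>: "\<And>x y. x \<in> carrier G \<Longrightarrow> y \<in> carrier G \<Longrightarrow> \<beta> x y \<in> carrier M"
        "\<And>x y z. x \<in> carrier G \<Longrightarrow> y \<in> carrier G \<Longrightarrow> z \<in> carrier G \<Longrightarrow>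
          f' [x, y, z] = cobd2 \<beta> x y z \<otimes>\<^bsub>M\<^esub> f [x, y, z]"
      by blast
    define \<phi> where "\<phi> = (\<lambda>gs\<in>tuples G 2. \<beta> (gs ! 0) (gs ! 1))"
    have \<phi>_eq: "\<phi> [x, y] = \<beta> x y" if "x \<in> carrier G" "y \<in> carrier G" for x y
      using that by (simp add: \<phi>_def tuples_def)
    have \<phi>: "\<phi> \<in> carrier (cochains G M 2)"
    proof -
      have "\<forall>gs\<in>tuples G 2. \<beta> (gs ! 0) (gs ! 1) \<in> carrier M"
        unfolding ball_tuples2 using \<beta>(1) by simp
      then show ?thesis
        by (auto simp: cochains_def \<phi>_def)
    qed
    have "\<forall>gs\<in>tuples G 3. f' gs = (coboundary G M act 2 \<phi> \<otimes>\<^bsub>cochains G M 3\<^esub> f) gs"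
      unfolding ball_tuples3
      by (simp add: mult coboundary2[OF \<phi>] \<beta>(2)) (simp add: cobd2_def \<phi>_eq)
    then have "f' = coboundary G M act 2 \<phi> \<otimes>\<^bsub>cochains G M 3\<^esub> f"
      by (intro cochains_eqI[OF f' mult_closed[OF coboundary_closed[OF \<phi>]]]) blast
    then show "f' \<in> cohomology_class G M act 3 f"
      using \<phi> by (auto simp: class_eq)
  qed
qed

lemma cohomology_class3_refl:
  assumes f: "f \<in> carrier (cochains G M 3)"
  shows "f \<in> cohomology_class G M act 3 f"
  using f cochains_closed[OF f]
  by (auto simp: cohomology_class3 cobd2_def intro!: exI[of _ "\<lambda>_ _. \<one>\<^bsub>M\<^esub>"])

lemma cohomology_class3_eq:
  assumes f: "f \<in> carrier (cochains G M 3)" and f': "f' \<in> cohomology_class G M act 3 f"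
  shows "cohomology_class G M act 3 f' = cohomology_class G M act 3 f"
proof -
  have trans: "h \<in> cohomology_class G M act 3 f"
    if f: "f \<in> carrier (cochains G M 3)" and g: "g \<in> cohomology_class G M act 3 f"
      and h: "h \<in> cohomology_class G M act 3 g" for f g h
  proof -
    have g': "g \<in> carrier (cochains G M 3)"
      using g by (simp add: cohomology_class3[OF f])
    obtain \<beta> where \<beta>: "\<And>x y. x \<in> carrier G \<Longrightarrow> y \<in> carrier G \<Longrightarrow> \<beta> x y \<in> carrier M"
        "\<And>x y z. x \<in> carrier G \<Longrightarrow> y \<in> carrier G \<Longrightarrow> z \<in> carrier G \<Longrightarrow>
          g [x, y, z] = cobd2 \<beta> x y z \<otimes>\<^bsub>M\<^esub> f [x, y, z]"
      using g unfolding cohomology_class3[OF f] by blast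
    obtain \<gamma> where h': "h \<in> carrier (cochains G M 3)" and
        \<gamma>: "\<And>x y. x \<in> carrier G \<Longrightarrow> y \<in> carrier G \<Longrightarrow> \<gamma> x y \<in> carrier M"
        "\<And>x y z. x \<in> carrier G \<Longrightarrow> y \<in> carrier G \<Longrightarrow> z \<in> carrier G \<Longrightarrow>
          h [x, y, z] = cobd2 \<gamma> x y z \<otimes>\<^bsub>M\<^esub> g [x, y, z]"
      using h unfolding cohomology_class3[OF g'] by blast
    show ?thesis
      unfolding cohomology_class3[OF f] using h' cochains_closed[OF f]
      by (auto simp: \<gamma> \<beta> cobd2_mult cobd2_closed m_assoc intro!: exI[of _ "\<lambda>x y. \<gamma> x y \<otimes>\<^bsub>M\<^esub> \<beta> x y"])
  qed
  have f'3: "f' \<in> carrier (cochains G M 3)"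
    using f' by (simp add: cohomology_class3[OF f])
  obtain \<beta> where \<beta>: "\<And>x y. x \<in> carrier G \<Longrightarrow> y \<in> carrier G \<Longrightarrow> \<beta> x y \<in> carrier M"
      "\<And>x y z. x \<in> carrier G \<Longrightarrow> y \<in> carrier G \<Longrightarrow> z \<in> carrier G \<Longrightarrow>
        f' [x, y, z] = cobd2 \<beta> x y z \<otimes>\<^bsub>M\<^esub> f [x, y, z]"
    using f' unfolding cohomology_class3[OF f] by blast
  have cancel: "inv\<^bsub>M\<^esub> u \<otimes>\<^bsub>M\<^esub> (u \<otimes>\<^bsub>M\<^esub> v) = v" if "u \<in> carrier M" "v \<in> carrier M" for u v
    using that by (simp flip: m_assoc)
  have "f \<in> cohomology_class G M act 3 f'"
    unfolding cohomology_class3[OF f'3] using f cochains_closed[OF f]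
    by (auto simp: \<beta> cobd2_inv cobd2_closed cancel intro!: exI[of _ "\<lambda>x y. inv\<^bsub>M\<^esub> (\<beta> x y)"])
  then show ?thesis
    using trans[OF f f'] trans[OF f'3] by blast
qed

text \<open>The cocycles of the complex of symmetric cochains, in the terms used above.\<close>

lemma symmetric_cocycles3:
  "cocycles (sym_cochains G M act) (coboundary G M act) 3 =
    {f \<in> carrier (cochains G M 3). cocycle3 (\<lambda>x y z. f [x, y, z]) \<and> symmetric3 (\<lambda>x y z. f [x, y, z])}"
proof -
  have sym: "(\<forall>i\<in>{1..3}. transp_act G M act 3 i f = f) \<longleftrightarrow> symmetric3 (\<lambda>x y z. f [x, y, z])"
    if f: "f \<in> carrier (cochains G M 3)" for f
  proof -
    have ext: "transp_act G M act 3 i f = f \<longleftrightarrow> (\<forall>gs\<in>tuples G 3. f gs = transp_act G M act 3 i f gs)" for i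
      using f by (auto simp: cochains_def transp_act_def fun_eq_iff PiE_iff extensional_def)
    have *: "{1..3::nat} = {1, 2, 3}"
      by auto
    have transp: "transp_act G M act 3 1 f [x, y, z] = inv\<^bsub>M\<^esub> (act x (f [inv x, x \<otimes> y, z]))"
        "transp_act G M act 3 2 f [x, y, z] = inv\<^bsub>M\<^esub> (f [x \<otimes> y, inv y, y \<otimes> z])"
        "transp_act G M act 3 3 f [x, y, z] = inv\<^bsub>M\<^esub> (f [x, y \<otimes> z, inv z])"
      if "x \<in> carrier G" "y \<in> carrier G" "z \<in> carrier G" for x y z
      using that by (simp_all add: transp_act_def tuples_def)
    show ?thesis
      unfolding ext * ball_tuples3 symmetric3_def ball_conj_distrib ball_simps
      by (simp add: transp del: One_nat_def)
  qed
  have coc: "coboundary G M act 3 f = \<one>\<^bsub>cochains G M 4\<^esub> \<longleftrightarrow> cocycle3 (\<lambda>x y z. f [x, y, z])"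
    if f: "f \<in> carrier (cochains G M 3)" for f
  proof -
    have [simp]: "f [a, b, c] \<in> carrier M" if "a \<in> carrier G" "b \<in> carrier G" "c \<in> carrier G" for a b c
      using cochains_closed[OF f, of "[a, b, c]"] that by simp
    have eq: "u \<otimes>\<^bsub>M\<^esub> inv\<^bsub>M\<^esub> v = \<one>\<^bsub>M\<^esub> \<longleftrightarrow> u = v" if "u \<in> carrier M" "v \<in> carrier M" for u v
      using that by (metis inv_closed inv_equality inv_inv r_inv)
    have "coboundary G M act 3 f = \<one>\<^bsub>cochains G M 4\<^esub> \<longleftrightarrow>
        (\<forall>gs\<in>tuples G 4. coboundary G M act 3 f gs = \<one>\<^bsub>M\<^esub>)"
      by (auto simp: coboundary_def cochains_def fun_eq_iff)
    also have "\<dots> \<longleftrightarrow> cocycle3 (\<lambda>x y z. f [x, y, z])"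
      unfolding ball_tuples4 cocycle3_def by (simp add: coboundary3[OF f] eq)
    finally show ?thesis .
  qed
  show ?thesis
    using sym coc
    by (auto simp: cocycles_def kernel_def sym_cochains_def)
qed

text \<open>The map \<open>alpha\<close> is given on a class by any representative, because coboundaries of symmetric
  cochains are in particular coboundaries.\<close>

lemma alpha_image:
  "alpha G M act 3 ` carrier (sym_cohomology G M act 3) =
    cohomology_class G M act 3 ` cocycles (sym_cochains G M act) (coboundary G M act) 3"
proof -
  let ?Z = "cocycles (sym_cochains G M act) (coboundary G M act) 3"
  let ?B = "\<lambda>f. {coboundary G M act 2 \<phi> \<otimes>\<^bsub>cochains G M 3\<^esub> f |\<phi>. \<phi> \<in> carrier (sym_cochains G M act 2)}"
  have "carrier (sym_cohomology G M act 3) = ?B ` ?Z"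
    by (auto simp: sym_cohomology_def cohomology_def FactGroup_def RCOSETS_def r_coset_def
        coboundaries_def sym_cochains_def numeral_3_eq_3 numeral_2_eq_2)
  moreover have "alpha G M act 3 (?B f) = cohomology_class G M act 3 f" if "f \<in> ?Z" for f
  proof -
    have f: "f \<in> carrier (cochains G M 3)"
      using that by (simp add: symmetric_cocycles3)
    have "?B f \<subseteq> cohomology_class G M act 3 f"
      by (auto simp: cohomology_class_def coboundaries_def r_coset_def sym_cochains_def numeral_3_eq_3 numeral_2_eq_2)
    moreover have "(\<lambda>gs\<in>tuples G 2. \<one>\<^bsub>M\<^esub>) \<in> carrier (sym_cochains G M act 2)" (is "?e \<in> _")
    proof -
      have "\<forall>gs\<in>tuples G 2. transp_act G M act 2 k ?e gs = \<one>\<^bsub>M\<^esub>" if "k \<in> {1..2}" for k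
        unfolding ball_tuples2 using that by (simp add: transp_act_def tuples_def)
      then show ?thesis
        by (auto simp: sym_cochains_def cochains_def transp_act_def fun_eq_iff)
    qed
    then have "?B f \<noteq> {}"
      by blast
    moreover have "h ` A = {c}" if "A \<noteq> {}" "\<And>a. a \<in> A \<Longrightarrow> h a = c"
      for A and c and h :: "('a list \<Rightarrow> 'c) \<Rightarrow> ('a list \<Rightarrow> 'c) set"
      using that by force
    ultimately have "cohomology_class G M act 3 ` ?B f = {cohomology_class G M act 3 f}"
      using cohomology_class3_eq[OF f] by (meson subsetD)
    then show ?thesis
      by (simp add: alpha_def)
  qed
  ultimately show ?thesis
    by (force simp: image_iff)
qed

end

context crossed_extension
begin

lemma lifting_cocycle_closed:
  assumes l: "lifting s \<sigma>"
  shows "lifting_cocycle G M T i act s \<sigma> \<in> carrier (cochains G M 3)"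
proof -
  have "\<forall>gs\<in>tuples G 3. lifting_cocycle G M T i act s \<sigma> gs \<in> carrier M"
    unfolding ball_tuples3 using lifting_defectD(1)[OF lifting_cocycle_defect[OF l]] by simp
  then show ?thesis
    by (auto simp: cochains_def lifting_cocycle_def)
qed

lemma crossed_extension_class_eq:
  assumes l: "lifting s \<sigma>"
  shows "crossed_extension_class G M actM T R i bd act p
    = cohomology_class G M actM 3 (lifting_cocycle G M T i act s \<sigma>)"
proof -
  have "cohomology_class G M actM 3 (lifting_cocycle G M T i act s' \<sigma>')
      = cohomology_class G M actM 3 (lifting_cocycle G M T i act s \<sigma>)" if l': "lifting s' \<sigma>'" for s' \<sigma>'
  proof (rule cohomology_class3_eq[OF lifting_cocycle_closed[OF l]])
    obtain \<beta> where "\<And>x y. x \<in> carrier G \<Longrightarrow> y \<in> carrier G \<Longrightarrow> \<beta> x y \<in> carrier M"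
      and "\<And>x y z. x \<in> carrier G \<Longrightarrow> y \<in> carrier G \<Longrightarrow> z \<in> carrier G
        \<Longrightarrow> lifting_cocycle G M T i act s' \<sigma>' [x, y, z]
          = cobd2 \<beta> x y z \<otimes>\<^bsub>M\<^esub> lifting_cocycle G M T i act s \<sigma> [x, y, z]"
      using lifting_defect_cohomologous[OF l lifting_cocycle_defect[OF l] l' lifting_cocycle_defect[OF l']]
      by blast
    then show "lifting_cocycle G M T i act s' \<sigma>'
        \<in> cohomology_class G M actM 3 (lifting_cocycle G M T i act s \<sigma>)"
      unfolding cohomology_class3[OF lifting_cocycle_closed[OF l]] using lifting_cocycle_closed[OF l'] by blast
  qed
  then show ?thesis
    unfolding crossed_extension_class_def using l by (intro the_equality) blast+
qed

lemma class_in_image_alpha_iff: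
  "crossed_extension_class G M actM T R i bd act p
      \<in> alpha G M actM 3 ` carrier (sym_cohomology G M actM 3)
    \<longleftrightarrow> (\<exists>s \<sigma>. symmetric_lifting s \<sigma>)"
proof -
  obtain s \<sigma> where l: "lifting s \<sigma>" and s1: "s \<one> = \<one>\<^bsub>R\<^esub>"
    by (rule normalised_lifting_exists)
  let ?f = "lifting_cocycle G M T i act s \<sigma>"
  let ?Z = "cocycles (sym_cochains G M actM) (coboundary G M actM) 3"
  note d = lifting_cocycle_defect[OF l]
  have fc: "?f [x, y, z] \<in> carrier M" if "x \<in> carrier G" "y \<in> carrier G" "z \<in> carrier G" for x y z
    using lifting_defectD(1)[OF d that] .
  note f = lifting_cocycle_closed[OF l]
  have "crossed_extension_class G M actM T R i bd act p
        \<in> alpha G M actM 3 ` carrier (sym_cohomology G M actM 3)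
      \<longleftrightarrow> (\<exists>f'\<in>?Z. cohomology_class G M actM 3 ?f = cohomology_class G M actM 3 f')"
    unfolding alpha_image crossed_extension_class_eq[OF l] by blast
  also have "\<dots> \<longleftrightarrow> (\<exists>f'\<in>?Z. f' \<in> cohomology_class G M actM 3 ?f)"
    using cohomology_class3_eq[OF f] cohomology_class3_refl symmetric_cocycles3 by blast
  also have "\<dots> \<longleftrightarrow> (\<exists>\<beta>. (\<forall>x\<in>carrier G. \<forall>y\<in>carrier G. \<beta> x y \<in> carrier M) \<and>
      cocycle3 (\<lambda>x y z. cobd2 \<beta> x y z \<otimes>\<^bsub>M\<^esub> ?f [x, y, z]) \<and>
      symmetric3 (\<lambda>x y z. cobd2 \<beta> x y z \<otimes>\<^bsub>M\<^esub> ?f [x, y, z]))" (is "?L \<longleftrightarrow> ?R")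
  proof
    assume ?L
    then obtain f' \<beta> where c: "cocycle3 (\<lambda>x y z. f' [x, y, z])" "symmetric3 (\<lambda>x y z. f' [x, y, z])"
      and \<beta>: "\<forall>x\<in>carrier G. \<forall>y\<in>carrier G. \<beta> x y \<in> carrier M"
      and eq: "\<And>x y z. x \<in> carrier G \<Longrightarrow> y \<in> carrier G \<Longrightarrow> z \<in> carrier G
        \<Longrightarrow> f' [x, y, z] = cobd2 \<beta> x y z \<otimes>\<^bsub>M\<^esub> ?f [x, y, z]"
      unfolding cohomology_class3[OF f] symmetric_cocycles3 by blast
    have "cocycle3 (\<lambda>x y z. cobd2 \<beta> x y z \<otimes>\<^bsub>M\<^esub> ?f [x, y, z])"
        "symmetric3 (\<lambda>x y z. cobd2 \<beta> x y z \<otimes>\<^bsub>M\<^esub> ?f [x, y, z])"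
      by (rule iffD1[OF cocycle3_cong c(1)] iffD1[OF symmetric3_cong c(2)], erule (2) eq)+
    with \<beta> show ?R
      by blast
  next
    assume ?R
    then obtain \<beta> where \<beta>: "\<And>x y. x \<in> carrier G \<Longrightarrow> y \<in> carrier G \<Longrightarrow> \<beta> x y \<in> carrier M"
      and c: "cocycle3 (\<lambda>x y z. cobd2 \<beta> x y z \<otimes>\<^bsub>M\<^esub> ?f [x, y, z])"
        "symmetric3 (\<lambda>x y z. cobd2 \<beta> x y z \<otimes>\<^bsub>M\<^esub> ?f [x, y, z])"
      by blast
    define f' where "f' = (\<lambda>gs\<in>tuples G 3. cobd2 \<beta> (gs ! 0) (gs ! 1) (gs ! 2) \<otimes>\<^bsub>M\<^esub> ?f gs)"
    have eq: "f' [x, y, z] = cobd2 \<beta> x y z \<otimes>\<^bsub>M\<^esub> ?f [x, y, z]"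
      if "x \<in> carrier G" "y \<in> carrier G" "z \<in> carrier G" for x y z
      using that by (simp add: f'_def tuples_def)
    have "\<forall>gs\<in>tuples G 3. f' gs \<in> carrier M"
      unfolding ball_tuples3 by (simp add: eq cobd2_closed \<beta> fc)
    then have f': "f' \<in> carrier (cochains G M 3)"
      by (auto simp: cochains_def f'_def)
    moreover have "cocycle3 (\<lambda>x y z. f' [x, y, z])" "symmetric3 (\<lambda>x y z. f' [x, y, z])"
      by (rule iffD2[OF cocycle3_cong c(1)] iffD2[OF symmetric3_cong c(2)], erule (2) eq)+
    ultimately show ?L
      unfolding cohomology_class3[OF f] symmetric_cocycles3 using \<beta> eq by blast
  qed
  also have "\<dots> \<longleftrightarrow> (\<exists>s \<sigma>. symmetric_lifting s \<sigma>)"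
    by (rule symmetric_lifting_iff[OF l s1 d, symmetric])
  finally show ?thesis .
qed

end

section \<open>Symmetric functors\<close>

lemma objs_Ca_simps:
  "carrier (objs (Ca T R bd act)) = carrier R"
  "x \<otimes>\<^bsub>objs (Ca T R bd act)\<^esub> y = x \<otimes>\<^bsub>R\<^esub> y"
  "\<one>\<^bsub>objs (Ca T R bd act)\<^esub> = \<one>\<^bsub>R\<^esub>"
  "inv\<^bsub>objs (Ca T R bd act)\<^esub> x = inv\<^bsub>R\<^esub> x"
  by (simp_all add: Ca_def m_inv_def)

lemma arrs_Ca_simps:
  "carrier (arrs (Ca T R bd act)) = carrier R \<times> carrier T"
  "(r, t) \<otimes>\<^bsub>arrs (Ca T R bd act)\<^esub> (x, u) = (r \<otimes>\<^bsub>R\<^esub> x, t \<otimes>\<^bsub>T\<^esub> act r u)"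
  "source (Ca T R bd act) (r, t) = r"
  "target (Ca T R bd act) (r, t) = bd t \<otimes>\<^bsub>R\<^esub> r"
  "ident (Ca T R bd act) r = (r, \<one>\<^bsub>T\<^esub>)"
  "(r', t') \<bullet>\<^bsub>Ca T R bd act\<^esub> (r, t) = (r, t' \<otimes>\<^bsub>T\<^esub> t)"
  by (simp_all add: Ca_def)

lemma hom_set_Ca:
  "a \<in> hom_set (Ca T R bd act) r r' \<longleftrightarrow>
     (\<exists>t. a = (r, t) \<and> r \<in> carrier R \<and> t \<in> carrier T \<and> bd t \<otimes>\<^bsub>R\<^esub> r = r')"
  by (cases a) (auto simp: hom_set_def arrs_Ca_simps)

lemmas Ca_simps = objs_Ca_simps arrs_Ca_simps hom_set_Ca

lemmas Ca_discrete_simps =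
  objs_Ca_simps[where T = "singleton_group ()" and bd = "\<lambda>_. \<one>\<^bsub>G\<^esub>" and R = G
      and act = "\<lambda>_ t. t" for G, folded Ca_discrete_def]
  arrs_Ca_simps[where T = "singleton_group ()" and bd = "\<lambda>_. \<one>\<^bsub>G\<^esub>" and R = G
      and act = "\<lambda>_ t. t" for G, folded Ca_discrete_def]

context crossed_extension
begin

lemma symmetric_lifting_of_section:
  assumes "symmetric_s_functor (Ca_discrete G) (Ca T R bd act) F F' \<xi>"
    and sec: "is_section (Ca_discrete G) p (Ca_proj_arr p) F F'"
  shows "\<exists>s \<sigma>. symmetric_lifting s \<sigma>"
proof -
  interpret S: symmetric_s_functor "Ca_discrete G" "Ca T R bd act" F F' \<xi>
    by (rule assms(1))
  define \<sigma> where "\<sigma> x y = snd (\<xi> x y)" for x y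
  have F [simp]: "F x \<in> carrier R" "p (F x) = x" if "x \<in> carrier G" for x
    using S.F_obj[of x] sec that by (simp_all add: Ca_discrete_simps Ca_simps is_section_def)
  have F1 [simp]: "F \<one> = \<one>\<^bsub>R\<^esub>"
    using S.F_one by (simp add: Ca_discrete_simps Ca_simps)
  have \<xi>: "\<xi> x y = (F (x \<otimes> y), \<sigma> x y)" "\<sigma> x y \<in> carrier T"
      "bd (\<sigma> x y) \<otimes>\<^bsub>R\<^esub> F (x \<otimes> y) = F x \<otimes>\<^bsub>R\<^esub> F y"
    if "x \<in> carrier G" "y \<in> carrier G" for x y
    using S.\<xi>_in_hom[of x y] that by (auto simp: Ca_discrete_simps Ca_simps \<sigma>_def)
  have "\<sigma> \<one> x = \<one>\<^bsub>T\<^esub>" "\<sigma> x \<one> = \<one>\<^bsub>T\<^esub>" if "x \<in> carrier G" for x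
    unfolding \<sigma>_def using S.\<xi>_one_left[of x] S.\<xi>_one_right[of x] that by (simp_all add: Ca_discrete_simps Ca_simps)
  moreover have "\<sigma> x y \<otimes>\<^bsub>T\<^esub> \<sigma> (x \<otimes> y) (inv y) = act (F x) (\<sigma> y (inv y))"
    if [simp]: "x \<in> carrier G" "y \<in> carrier G" for x y
    using S.symmetric_right[of x y]
    by (simp add: Ca_discrete_simps Ca_simps \<xi>(2) \<xi>(1)[of x y] \<xi>(1)[of "x \<otimes> y" "inv y"] \<xi>(1)[of y "inv y"])
  moreover have "act (F x) (\<sigma> (inv x) y) \<otimes>\<^bsub>T\<^esub> \<sigma> x (inv x \<otimes> y) = \<sigma> x (inv x)"
    if [simp]: "x \<in> carrier G" "y \<in> carrier G" for x y
    using S.symmetric_left[of x y]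
    by (simp add: Ca_discrete_simps Ca_simps \<xi>(2) \<xi>(1)[of "inv x" y] \<xi>(1)[of x "inv x \<otimes> y"] \<xi>(1)[of x "inv x"])
  ultimately have "symmetric_lifting F \<sigma>"
    using \<xi>(2,3) by (simp add: symmetric_lifting_def lifting_pair_def)
  then show ?thesis
    by blast
qed

text \<open>As all arrows of the discrete category are identities, the arrow part of the functor is forced.\<close>

lemma section_of_symmetric_lifting:
  assumes sl: "symmetric_lifting s \<sigma>"
  defines "F' \<equiv> \<lambda>(x, _). (s x, \<one>\<^bsub>T\<^esub>)" and "\<xi> \<equiv> \<lambda>x y. (s (x \<otimes> y), \<sigma> x y)"
  shows "symmetric_s_functor (Ca_discrete G) (Ca T R bd act) s F' \<xi>"
    and "is_section (Ca_discrete G) p (Ca_proj_arr p) s F'"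
proof -
  have l: "lifting s \<sigma>"
    using sl by (simp add: symmetric_lifting_def)
  note [simp] = liftingD[OF l] lifting_bd[OF l]
  interpret C: strict_two_group "Ca_discrete G"
    by (rule strict_two_group_Ca_discrete) (rule base.is_group)
  interpret D: strict_two_group "Ca T R bd act"
    by (rule strict_two_group_Ca) (rule crossed_module_axioms)
  show "symmetric_s_functor (Ca_discrete G) (Ca T R bd act) s F' \<xi>"
    using sl
    by unfold_locales (auto simp: Ca_discrete_simps Ca_simps F'_def \<xi>_def symmetric_lifting_def base.m_assoc)
  show "is_section (Ca_discrete G) p (Ca_proj_arr p) s F'"
    by (auto simp: is_section_def Ca_discrete_simps F'_def Ca_proj_arr_def)
qed

end

theorem mainTheorem2:
  fixes G :: "('g, 'x) monoid_scheme" and M :: "('m, 'w) monoid_scheme"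
    and T :: "('t, 'y) monoid_scheme" and R :: "('r, 'z) monoid_scheme"
    and actM :: "'g \<Rightarrow> 'm \<Rightarrow> 'm" and i :: "'m \<Rightarrow> 't" and bd :: "'t \<Rightarrow> 'r"
    and act :: "'r \<Rightarrow> 't \<Rightarrow> 't" and p :: "'r \<Rightarrow> 'g"
  assumes "crossed_extension G M actM T R i bd act p"
  shows "crossed_extension_class G M actM T R i bd act p
            \<in> alpha G M actM 3 ` carrier (sym_cohomology G M actM 3)
     \<longleftrightarrow> (\<exists>F F' \<xi>. symmetric_s_functor (Ca_discrete G) (Ca T R bd act) F F' \<xi>
            \<and> is_section (Ca_discrete G) p (Ca_proj_arr p) F F')"
proof -
  interpret crossed_extension G M actM T R i bd act p
    by (rule assms)
  show ?thesis
    unfolding class_in_image_alpha_iff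
    using symmetric_lifting_of_section section_of_symmetric_lifting by blast
qed

end
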